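(* Let $M\ge 7$ be an integer congruent to $2$ or $3$ modulo $5$, and let $N\ge 1$, $k\ge 0$, $j\ge 0$ be integers. The number of partitions of $N$ into parts congruent to $2$ or $3$ modulo $5$ with exactly $k$ parts equal to $M$ and exactly $j$ parts equal to $2$ is equal to the number of partitions $\lambda\in\mathsf{Diff_2}^*$ of $N$ such that one of the following holds: (1) $\lambda$ consists of exactly one part, of size $N=2j$ or $N=2j+3$, and $k=0$; (2) $\lambda$ has exactly two parts, $col^*(\lambda)$ has exactly $j$ $2$'s, and the number of $1$'s in $col^*(\lambda)$ is either $Mk+i$ for some $0\le i\le M-1$ with $i\ne M-3,\,M-6$ (where $k\ge 0$), or it is $M(k-1)+M-3$ or $M(k-1)+M-6$ (where $k\ge 1$); (3) $\lambda$ has between three and $M-1$ parts (inclusive), and $col^*(\lambda)$ has exactly $j$ $2$'s and between $Mk$ and $Mk+M-1$ (inclusive) $1$'s; (4) $\lambda$ has at least $M$ parts, and $col^*(\lambda)$ has exactly $j$ $2$'s and exactly $k$ $M$'s.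
   Context: Partitions are written with weakly decreasing positive parts. $\mathsf{Diff_2}$ is the set of partitions $\lambda=(\lambda_1,\dots,\lambda_m)$ whose consecutive differences are at least two, i.e. $\lambda_i-\lambda_{i+1}\ge 2$ for $1\le i<m$. $\mathsf{Diff_2}^*$ is the subset of those partitions in $\mathsf{Diff_2}$ with no part equal to $1$. For $\lambda=(\lambda_1,\dots,\lambda_m)\in\mathsf{Diff_2}^*$, $col^*(\lambda)$ is the partition formed by the columns of (i.e. the conjugate of) $(\lambda_1-2m,\lambda_2-2(m-1),\dots,\lambda_m-2)$, where zero entries are ignored. Example: $col^*((13,10,6,4))=(5,4,2,2)^T=(4,4,2,2,1)$. *)

theory Defs
  imports Main
begin

definition is_partition :: "nat list \<Rightarrow> bool" where
  "is_partition xs \<longleftrightarrow> sorted_wrt (\<ge>) xs \<and> (\<forall>x\<in>set xs. 0 < x)"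

definition is_partition_of :: "nat list \<Rightarrow> nat \<Rightarrow> bool" where
  "is_partition_of xs N \<longleftrightarrow> is_partition xs \<and> sum_list xs = N"

definition Diff2 :: "nat list set" where
  "Diff2 = {xs. is_partition xs \<and>
     (\<forall>i. Suc i < length xs \<longrightarrow> xs ! i - xs ! Suc i \<ge> 2)}"

definition Diff2_star :: "nat list set" where
  "Diff2_star = {xs \<in> Diff2. 1 \<notin> set xs}"

text \<open>The entry at index \<open>c\<close>, counting from 0, is the length of column \<open>c + 1\<close> of the
  Ferrers diagram.\<close>

definition conjugate :: "nat list \<Rightarrow> nat list" where
  "conjugate xs =
     map (\<lambda>c. length (filter (\<lambda>p. c < p) xs)) [0..<(if xs = [] then 0 else hd xs)]"

text \<open>With list indices starting at 0, the amount subtracted from \<open>xs ! i\<close> is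
  \<open>2 * (length xs - i)\<close>. On \<open>Diff2_star\<close> the subtraction never truncates.\<close>

definition col_star :: "nat list \<Rightarrow> nat list" where
  "col_star xs =
     conjugate (filter (\<lambda>p. p \<noteq> 0)
       (map (\<lambda>i. xs ! i - 2 * (length xs - i)) [0..<length xs]))"

lemma col_star_example: "col_star [13, 10, 6, 4] = [4, 4, 2, 2, 1]"
  by code_simp

end

theory Submission
  imports Defs "HOL-Computational_Algebra.Formal_Laurent_Series" "HOL-Library.Multiset"
begin

text \<open>
  Both sides are compared through generating functions in \<open>X\<close>, with \<open>k\<close> and \<open>j\<close> fixed.
  Put \<open>K = X^(2j + Mk) (1 - X^2) (1 - X^M)\<close>.  Fixing the multiplicities of \<open>2\<close> and \<open>M\<close> turns
  the product for the parts \<open>2, 3\<close> modulo \<open>5\<close> into \<open>K\<close> times that product, which by the second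
  Rogers-Ramanujan identity is the sum of \<open>K X^(m(m+1)) / (X; X)_m\<close> over \<open>m\<close>.  On the other side,
  \<open>col_star\<close> identifies the members of \<open>Diff2_star\<close> with \<open>m\<close> parts with the partitions into
  parts at most \<open>m\<close>, the size dropping by \<open>m(m+1)\<close>.  For \<open>m \<ge> 3\<close> the conditions on
  multiplicities reproduce exactly the \<open>m\<close>-th summand: when \<open>m < M\<close>, blocks of \<open>M\<close> ones
  replace the missing parts \<open>M\<close>.  For \<open>m \<le> 2\<close> only the total agrees, and the exceptional values
  \<open>M - 3\<close> and \<open>M - 6\<close> compensate for the difference.

  The Rogers-Ramanujan identity is obtained from the unit Bailey pair relative to \<open>q\<close> by two
  applications of the Bailey chain, followed by the Jacobi triple product with base \<open>q^5\<close>.  The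
  finite forms hold in every field in which \<open>q\<close> is not a root of unity, in particular in Laurent
  series, hence for power series; the limit is replaced by comparing coefficients up to a given
  degree.
\<close>

subsection \<open>Finite identities for the \<open>q\<close>-factorial\<close>

text \<open>The q-Pochhammer symbol \<open>(q; q)_n\<close>. The base is an argument because
  \<open>X\<close> and \<open>X ^ 5\<close> both serve as bases.\<close>

definition qfac :: "'a::comm_ring_1 \<Rightarrow> nat \<Rightarrow> 'a" where
  "qfac q n = (\<Prod>i<n. 1 - q ^ Suc i)"

lemma qfac_0 [simp]: "qfac q 0 = 1"
  by (simp add: qfac_def)

lemma qfac_Suc: "qfac q (Suc n) = qfac q n * (1 - q ^ Suc n)"
  by (simp add: qfac_def)

lemma Suc_choose_2: "Suc n choose 2 = (n choose 2) + n"
  by (simp add: numeral_2_eq_2)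

text \<open>The Gaussian binomial coefficient. The value 0 for \<open>k > n\<close> lets the first
  form of Pascal's rule hold without a bound on \<open>k\<close>.\<close>

definition qbin :: "'a::field \<Rightarrow> nat \<Rightarrow> nat \<Rightarrow> 'a" where
  "qbin q n k = (if k \<le> n then qfac q n / (qfac q k * qfac q (n - k)) else 0)"

lemma qfac_nonzero:
  fixes q :: "'a::field"
  assumes q_pow: "\<And>n. q ^ Suc n \<noteq> 1"
  shows "qfac q n \<noteq> 0"
  using q_pow by (auto simp: qfac_def simp del: power_Suc)

lemma qbin_0:
  fixes q :: "'a::field"
  assumes q_pow: "\<And>n. q ^ Suc n \<noteq> 1"
  shows "qbin q n 0 = 1"
  using qfac_nonzero [OF q_pow] by (simp add: qbin_def)

text \<open>The numerator factor \<open>1 - q ^ Suc n\<close> is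
  \<open>q ^ Suc k * (1 - q ^ (n - k)) + (1 - q ^ Suc k)\<close>, and each summand cancels one
  factor of the denominator.\<close>

lemma qbin_Suc_Suc:
  fixes q :: "'a::field"
  assumes q_pow: "\<And>n. q ^ Suc n \<noteq> 1"
  shows "qbin q (Suc n) (Suc k) = q ^ Suc k * qbin q n (Suc k) + qbin q n k"
proof -
  consider "k > n" | "k = n" | "k < n" by linarith
  then show ?thesis
  proof cases
    case 2
    then show ?thesis using qfac_nonzero [OF q_pow] by (simp add: qbin_def)
  next
    case 3
    then obtain d where n: "n = k + Suc d" using less_imp_Suc_add by auto
    have [simp]: "k + d - k = d" "Suc (k + d) - k = Suc d" by simp_all
    have nz: "qfac q d \<noteq> 0" "qfac q k \<noteq> 0" "1 - q ^ Suc d \<noteq> 0" "1 - q ^ Suc k \<noteq> 0"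
      using qfac_nonzero [OF q_pow] q_pow by (auto simp del: power_Suc)
    have eq: "1 - q ^ Suc n = q ^ Suc k * (1 - q ^ Suc d) + (1 - q ^ Suc k)"
      by (simp add: n algebra_simps power_add)
    have "qbin q (Suc n) (Suc k) = qfac q n * (1 - q ^ Suc n)
            / (qfac q k * (1 - q ^ Suc k) * (qfac q d * (1 - q ^ Suc d)))"
      unfolding qbin_def n by (simp add: qfac_Suc del: power_Suc)
    also have "\<dots> = q ^ Suc k * (qfac q n / (qfac q k * (1 - q ^ Suc k) * qfac q d))
            + qfac q n / (qfac q k * (qfac q d * (1 - q ^ Suc d)))"
      unfolding eq using nz by (simp add: divide_simps del: power_Suc) (simp add: algebra_simps)
    also have "\<dots> = q ^ Suc k * qbin q n (Suc k) + qbin q n k"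
      unfolding qbin_def n by (simp add: qfac_Suc del: power_Suc)
    finally show ?thesis .
  qed (simp add: qbin_def)
qed

lemma qbin_symmetric:
  fixes q :: "'a::field"
  assumes q_pow: "\<And>n. q ^ Suc n \<noteq> 1"
    and "k \<le> n"
  shows "qbin q n (n - k) = qbin q n k"
  using assms(2) by (simp add: qbin_def mult.commute)

text \<open>Reflecting \<open>k\<close> to \<open>n - k\<close> interchanges the two neighbours in
  Pascal's rule and so yields its other form.\<close>

lemma qbin_Suc_Suc':
  fixes q :: "'a::field"
  assumes q_pow: "\<And>n. q ^ Suc n \<noteq> 1"
    and "k \<le> n"
  shows "qbin q (Suc n) (Suc k) = qbin q n (Suc k) + q ^ (n - k) * qbin q n k"
proof (cases "k = n")
  case True
  then show ?thesis using qfac_nonzero [OF q_pow] by (simp add: qbin_def)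
next
  case False
  then obtain d where n: "n = k + Suc d" using assms(2) less_imp_Suc_add[of k n] by auto
  have "qbin q (Suc n) (Suc k) = qbin q (Suc n) (Suc d)"
    using qbin_symmetric [OF q_pow, of "Suc k" "Suc n"] by (simp add: n)
  also have "\<dots> = q ^ Suc d * qbin q n (Suc d) + qbin q n d"
    by (rule qbin_Suc_Suc [OF q_pow])
  also have "qbin q n (Suc d) = qbin q n k" using qbin_symmetric [OF q_pow, of k n] by (simp add: n)
  also have "qbin q n d = qbin q n (Suc k)" using qbin_symmetric [OF q_pow, of d n] by (simp add: n)
  finally show ?thesis by (simp add: n)
qed

text \<open>Writing \<open>f k d\<close> for the left-hand side, Pascal's rule gives \<open>f (Suc k) d = f k (Suc d)\<close>.\<close>

lemma sum_qbin_div_qfac: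
  fixes q :: "'a::field"
  assumes q_pow: "\<And>n. q ^ Suc n \<noteq> 1"
  shows "(\<Sum>t\<le>k. q ^ (t * (t + d)) * qbin q k t / qfac q (t + d)) = 1 / qfac q (k + d)"
proof (induction k arbitrary: d)
  case 0
  then show ?case by (simp add: qbin_0 [OF q_pow])
next
  case (Suc k)
  let ?B = "\<lambda>t. qbin q k t"
  have nz: "qfac q n \<noteq> 0" "1 - q ^ Suc n \<noteq> 0" for n
    using qfac_nonzero [OF q_pow] q_pow by (auto simp del: power_Suc)
  have "(\<Sum>t\<le>Suc k. q ^ (t * (t + d)) * qbin q (Suc k) t / qfac q (t + d))
      = 1 / qfac q d + (\<Sum>t\<le>k. q ^ (Suc t * (Suc t + d)) * (q ^ Suc t * ?B (Suc t) + ?B t)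
           / qfac q (Suc t + d))"
    by (subst sum.atMost_Suc_shift) (simp add: qbin_Suc_Suc [OF q_pow] qbin_0 [OF q_pow] del: power_Suc mult_Suc)
  also have "\<dots> = (1 / qfac q d + (\<Sum>t\<le>k. q ^ (Suc t * (Suc t + Suc d)) * ?B (Suc t)
           / qfac q (Suc t + d)))
        + (\<Sum>t\<le>k. q ^ (Suc t * (Suc t + d)) * ?B t / qfac q (Suc t + d))"
    by (simp add: sum.distrib [symmetric] power_add algebra_simps add_divide_distrib)
  also have "1 / qfac q d + (\<Sum>t\<le>k. q ^ (Suc t * (Suc t + Suc d)) * ?B (Suc t)
           / qfac q (Suc t + d)) = (\<Sum>t\<le>Suc k. q ^ (t * (t + Suc d)) * ?B t / qfac q (t + d))"
    by (subst sum.atMost_Suc_shift) (simp add: qbin_0 [OF q_pow] del: power_Suc mult_Suc)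
  also have "\<dots> = (\<Sum>t\<le>k. q ^ (t * (t + Suc d)) * ?B t / qfac q (t + d))"
    by (simp add: qbin_def)
  \<comment> \<open>Since \<open>1 / qfac q (t + d)\<close> is
    \<open>(1 - q ^ Suc (t + d)) / qfac q (Suc t + d)\<close>, each term splits off the negative of
    the matching term in the other sum.\<close>
  also have "\<dots> = (\<Sum>t\<le>k. q ^ (t * (t + Suc d)) * ?B t / qfac q (t + Suc d)
                - q ^ (Suc t * (Suc t + d)) * ?B t / qfac q (Suc t + d))"
  proof (rule sum.cong)
    fix t
    have e: "q ^ (Suc t * (Suc t + d)) = q ^ (t * (t + Suc d)) * q ^ Suc (t + d)"
      by (simp add: power_add [symmetric] algebra_simps)
    show "q ^ (t * (t + Suc d)) * ?B t / qfac q (t + d)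
      = q ^ (t * (t + Suc d)) * ?B t / qfac q (t + Suc d)
                - q ^ (Suc t * (Suc t + d)) * ?B t / qfac q (Suc t + d)"
      unfolding e using nz[of "t + d"]
      by (simp add: qfac_Suc divide_simps del: power_Suc) (simp add: algebra_simps)
  qed simp
  also have "\<dots> = 1 / qfac q (k + Suc d)
        - (\<Sum>t\<le>k. q ^ (Suc t * (Suc t + d)) * ?B t / qfac q (Suc t + d))"
    by (simp only: sum_subtractf Suc.IH)
  finally show ?case by simp
qed

section \<open>The Bailey chain and the unit Bailey pair relative to \<open>q\<close>\<close>

text \<open>Bailey's lemma with both free parameters sent to infinity;
  \<open>qfac q (n + r + 1)\<close> stands for the usual \<open>(q ^ 2; q)_(n + r)\<close> up to the
  factor \<open>1 - q\<close>. After exchanging the summations, the inner sum over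
  \<open>t = s - r\<close> is \<open>sum_qbin_div_qfac\<close> with \<open>k = n - r\<close> and
  \<open>d = 2 * r + 1\<close>.\<close>

lemma bailey_chain:
  fixes q :: "'a::field"
  assumes q_pow: "\<And>n. q ^ Suc n \<noteq> 1"
  shows "(\<Sum>r\<le>n. q ^ (r * (r + 1)) * A r / (qfac q (n - r) * qfac q (n + r + 1)))
   = (\<Sum>s\<le>n. q ^ (s * (s + 1)) / qfac q (n - s)
        * (\<Sum>r\<le>s. A r / (qfac q (s - r) * qfac q (s + r + 1))))"
proof -
  define g where "g r t = q ^ ((r + t) * (r + t + 1)) / qfac q (n - (r + t))
        * (A r / (qfac q t * qfac q (r + t + r + 1)))" for r t
  have inner: "(\<Sum>t\<le>n - r. g r t) = q ^ (r * (r + 1)) * A r / (qfac q (n - r) * qfac q (n + r + 1))"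
    if "r \<le> n" for r
  proof -
    have "(\<Sum>t\<le>n - r. g r t) = (\<Sum>t\<le>n - r. q ^ (r * (r + 1)) * A r / qfac q (n - r)
        * (q ^ (t * (t + (2 * r + 1))) * qbin q (n - r) t / qfac q (t + (2 * r + 1))))"
    proof (rule sum.cong)
      fix t assume "t \<in> {..n - r}"
      moreover have "q ^ ((r + t) * (r + t + 1)) = q ^ (r * (r + 1)) * q ^ (t * (t + (2 * r + 1)))"
      proof -
        have "(r + t) * (r + t + 1) = r * (r + 1) + t * (t + (2 * r + 1))"
          by (simp add: algebra_simps)
        then show ?thesis by (simp only: power_add)
      qed
      moreover have "r + t + r + 1 = t + (2 * r + 1)" "n - (r + t) = n - r - t" by simp_all
      moreover from calculation have "t \<le> n - r" by simp
      ultimately show "g r t = q ^ (r * (r + 1)) * A r / qfac q (n - r)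
        * (q ^ (t * (t + (2 * r + 1))) * qbin q (n - r) t / qfac q (t + (2 * r + 1)))"
        unfolding g_def using qfac_nonzero [OF q_pow]
        by (simp only: qbin_def) (simp add: mult_ac)
    qed simp
    also have "\<dots> = q ^ (r * (r + 1)) * A r / qfac q (n - r) * (1 / qfac q (n - r + (2 * r + 1)))"
      by (simp only: sum_distrib_left [symmetric] sum_qbin_div_qfac [OF q_pow])
    also have "n - r + (2 * r + 1) = n + r + 1" using that by simp
    finally show ?thesis by simp
  qed
  have "(\<Sum>s\<le>n. q ^ (s * (s + 1)) / qfac q (n - s)
        * (\<Sum>r\<le>s. A r / (qfac q (s - r) * qfac q (s + r + 1)))) = (\<Sum>s\<le>n. \<Sum>r\<le>s. g r (s - r))"
    by (simp add: g_def sum_distrib_left)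
  also have "\<dots> = (\<Sum>(r, t)\<in>{(r, t). r + t \<le> n}. g r t)"
    by (rule sum.triangle_reindex_eq [symmetric])
  also have "{(r, t). r + t \<le> n} = Sigma {..n} (\<lambda>r. {..n - r})"
    by auto
  also have "(\<Sum>(r, t)\<in>Sigma {..n} (\<lambda>r. {..n - r}). g r t) = (\<Sum>r\<le>n. \<Sum>t\<le>n - r. g r t)"
    by (rule sum.Sigma [symmetric]) auto
  finally show ?thesis using inner by simp
qed

text \<open>The sum telescopes after multiplication by \<open>1 - q ^ n\<close>.\<close>

lemma unit_bailey_pair:
  fixes q :: "'a::field"
  assumes q_pow: "\<And>n. q ^ Suc n \<noteq> 1"
  shows "(\<Sum>r\<le>n. (-1) ^ r * q ^ (r choose 2) * (1 - q ^ (2 * r + 1))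
       / (qfac q (n - r) * qfac q (n + r + 1))) = (if n = 0 then 1 else 0)"
proof (cases n)
  case 0
  then show ?thesis using qfac_nonzero [OF q_pow, of 1] by (simp add: qfac_Suc binomial_eq_0)
next
  case (Suc n')
  have nz: "qfac q i \<noteq> 0" "1 - q ^ Suc i \<noteq> 0" for i
    using qfac_nonzero [OF q_pow] q_pow by (auto simp del: power_Suc)
  define t where "t r = (-1) ^ r * q ^ (r choose 2) * (1 - q ^ (2 * r + 1))
       / (qfac q (n - r) * qfac q (n + r + 1))" for r
  \<comment> \<open>The closed form stops at \<open>R < n\<close>, beyond which
    \<open>n - Suc R\<close> would truncate; the term \<open>r = n\<close> is added at the end and
    cancels it.\<close>
  have part: "(1 - q ^ n) * (\<Sum>r\<le>R. t r)
      = (-1) ^ R * q ^ (Suc R choose 2) * (1 - q ^ Suc R) / (qfac q (n - Suc R) * qfac q (n + Suc R))"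
    if "R < n" for R
    using that
  proof (induction R)
    case 0
    have "qfac q n = qfac q n' * (1 - q ^ n)" by (simp only: Suc qfac_Suc)
    moreover have "1 - q ^ n \<noteq> 0" "n - Suc 0 = n'" using nz(2)[of n'] by (simp_all add: Suc)
    moreover have "t 0 = (1 - q) / (qfac q n * qfac q (n + 1))"
      by (simp add: t_def binomial_eq_0)
    ultimately show ?case
      by (simp add: binomial_eq_0)
  next
    case (Suc R)
    obtain d where n: "n = Suc (R + Suc d)" using less_imp_Suc_add [OF Suc.prems] by auto
    then have eqs: "n - Suc R = Suc d" "n - Suc (Suc R) = d" "n + Suc R + 1 = Suc (n + Suc R)"
       "n + Suc (Suc R) = Suc (n + Suc R)" "2 * Suc R + 1 = Suc R + Suc (Suc R)"
      by auto
    note tri = Suc_choose_2 [of "Suc R"]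
    \<comment> \<open>In these letters the induction step becomes a polynomial identity;
      \<open>w = x * x * y * q\<close> because
      \<open>n + R + 2 = 2 * (R + 1) + (d + 1) + 1\<close>.\<close>
    define x y w where "x = q ^ Suc R" and "y = q ^ Suc d" and "w = q ^ (n + Suc (Suc R))"
    have w: "w = x * x * y * q" and qn: "q ^ n = x * y"
      unfolding w_def x_def y_def power_add [symmetric] power_Suc2 [symmetric] by (simp_all add: n mult_ac power_add)
    have nz': "1 - y \<noteq> 0" "1 - w \<noteq> 0" using nz(2)[of d] nz(2)[of "n + Suc R"] by (simp_all add: y_def w_def)
    have tS: "t (Suc R) = - ((-1) ^ R) * q ^ (Suc R choose 2) * (1 - x * (x * q))
         / (qfac q d * (1 - y) * (qfac q (n + Suc R) * (1 - w)))"
      unfolding t_def eqs qfac_Suc by (simp add: x_def y_def w_def power_add algebra_simps)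
    have "(1 - q ^ n) * (\<Sum>r\<le>Suc R. t r)
       = (-1) ^ R * q ^ (Suc R choose 2) * (1 - x) / (qfac q d * (1 - y) * qfac q (n + Suc R))
         + (1 - q ^ n) * t (Suc R)"
      using Suc.IH Suc.prems eqs(1) by (simp add: distrib_left qfac_Suc x_def y_def del: power_Suc)
    also have "\<dots> = (-1) ^ R * q ^ (Suc R choose 2) * ((1 - x) * (1 - w) - (1 - x * y) * (1 - x * (x * q)))
          / (qfac q d * (1 - y) * qfac q (n + Suc R) * (1 - w))"
      unfolding tS qn using nz nz' by (simp add: divide_simps) (simp add: algebra_simps)
    also have "(1 - x) * (1 - w) - (1 - x * y) * (1 - x * (x * q)) = - x * (1 - x * q) * (1 - y)"
      unfolding w by (simp add: algebra_simps)
    also have "(-1) ^ R * q ^ (Suc R choose 2) * (- x * (1 - x * q) * (1 - y))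
          / (qfac q d * (1 - y) * qfac q (n + Suc R) * (1 - w))
       = (-1) ^ Suc R * q ^ (Suc (Suc R) choose 2) * (1 - q ^ Suc (Suc R))
          / (qfac q d * (qfac q (n + Suc R) * (1 - w)))"
    proof -
      have "q ^ Suc (Suc R) = x * q" "q ^ (Suc (Suc R) choose 2) = q ^ (Suc R choose 2) * x"
        by (simp_all only: tri power_add x_def power_Suc2 [of q "Suc R"])
      then show ?thesis
        using nz' nz(1)[of d] nz(1)[of "n + Suc R"]
        by (simp only: power_Suc) (simp add: divide_simps)
    qed
    finally show ?case unfolding eqs(2,4) qfac_Suc w_def eqs(4) .
  qed
  have "(1 - q ^ n) * (\<Sum>r\<le>n. t r) = (1 - q ^ n) * (\<Sum>r\<le>n'. t r) + (1 - q ^ n) * t n"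
    by (simp add: Suc distrib_left)
  also have "(1 - q ^ n) * t n = - ((-1) ^ n' * q ^ (n choose 2) * (1 - q ^ n) / qfac q (n + n))"
    using nz(2)[of "n + n"] nz(1)[of "n + n"]
    by (simp add: t_def Suc qfac_Suc mult_2 del: power_Suc) (simp add: mult_ac)
  also have "(1 - q ^ n) * (\<Sum>r\<le>n'. t r) = (-1) ^ n' * q ^ (n choose 2) * (1 - q ^ n) / qfac q (n + n)"
    using part[of n'] by (simp add: Suc del: power_Suc)
  finally have "(1 - q ^ n) * (\<Sum>r\<le>n. t r) = 0" by simp
  then show ?thesis using nz(2)[of n'] by (simp add: Suc t_def del: power_Suc sum.atMost_Suc)
qed

text \<open>The unit pair is supported at index 0, so one pass through the chain gives
  \<open>1 / qfac q s\<close> and a second pass gives the right-hand side. The exponent on the left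
  is \<open>2 * r * (r + 1) + (r choose 2)\<close>.\<close>

lemma finite_rogers_ramanujan:
  fixes q :: "'a::field"
  assumes q_pow: "\<And>n. q ^ Suc n \<noteq> 1"
  shows "(\<Sum>r\<le>n. (-1) ^ r * q ^ (5 * (r choose 2) + 4 * r) * (1 - q ^ (2 * r + 1))
       / (qfac q (n - r) * qfac q (n + r + 1)))
   = (\<Sum>s\<le>n. q ^ (s * (s + 1)) / (qfac q (n - s) * qfac q s))"
proof -
  define A where "A r = (-1) ^ r * q ^ (r choose 2) * (1 - q ^ (2 * r + 1))" for r
  have step1: "(\<Sum>r\<le>s. q ^ (r * (r + 1)) * A r / (qfac q (s - r) * qfac q (s + r + 1))) = 1 / qfac q s" for s
  proof -
    have "(\<Sum>r\<le>s. q ^ (r * (r + 1)) * A r / (qfac q (s - r) * qfac q (s + r + 1)))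
      = (\<Sum>i\<le>s. q ^ (i * (i + 1)) / qfac q (s - i) * (if i = 0 then 1 else 0))"
      unfolding bailey_chain [OF q_pow] A_def unit_bailey_pair [OF q_pow] ..
    also have "\<dots> = (\<Sum>i\<le>s. if i = 0 then 1 / qfac q s else 0)"
      by (rule sum.cong) auto
    finally show ?thesis by simp
  qed
  have sq: "2 * (r choose 2) + r = r * r" for r :: nat
    by (cases r) (simp_all add: choose_two)
  have "5 * (r choose 2) + 4 * r = r * (r + 1) + (r * (r + 1) + (r choose 2))" for r
    using sq[of r] by (simp add: algebra_simps)
  then have e: "q ^ (5 * (r choose 2) + 4 * r) = q ^ (r * (r + 1)) * (q ^ (r * (r + 1)) * q ^ (r choose 2))" for r
    by (simp only: power_add)
  have "(\<Sum>r\<le>n. (-1) ^ r * q ^ (5 * (r choose 2) + 4 * r) * (1 - q ^ (2 * r + 1))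
       / (qfac q (n - r) * qfac q (n + r + 1)))
      = (\<Sum>r\<le>n. q ^ (r * (r + 1)) * (q ^ (r * (r + 1)) * A r)
       / (qfac q (n - r) * qfac q (n + r + 1)))"
    unfolding e A_def by (simp only: mult_ac)
  also have "\<dots> = (\<Sum>s\<le>n. q ^ (s * (s + 1)) / qfac q (n - s) * (1 / qfac q s))"
    unfolding bailey_chain [OF q_pow, where A = "\<lambda>r. q ^ (r * (r + 1)) * A r"] step1 ..
  finally show ?thesis by simp
qed

section \<open>The q-binomial theorem and the finite Jacobi triple product\<close>

text \<open>Multiplying by the last factor \<open>w - x * q ^ m\<close> reproduces the second form
  of Pascal's rule. With the variable \<open>w\<close>, which later becomes a power of
  \<open>q\<close>, negative exponents are avoided.\<close>

lemma q_binomial_theorem: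
  fixes q :: "'a::field"
  assumes q_pow: "\<And>n. q ^ Suc n \<noteq> 1"
  shows "(\<Prod>l<m. w - x * q ^ l) = (\<Sum>i\<le>m. (- x) ^ i * q ^ (i choose 2) * w ^ (m - i) * qbin q m i)"
proof (induction m)
  case 0
  then show ?case by (simp add: qbin_0 [OF q_pow] binomial_eq_0)
next
  case (Suc m)
  let ?c = "\<lambda>m i. (- x) ^ i * q ^ (i choose 2) * w ^ (m - i) * qbin q m i"
  have "(\<Sum>i\<le>m. ?c m i * w) = (\<Sum>i\<le>Suc m. (- x) ^ i * q ^ (i choose 2) * w ^ (Suc m - i) * qbin q m i)"
    by (simp add: Suc_diff_le qbin_def mult_ac)
  also have "\<dots> = w ^ Suc m + (\<Sum>i\<le>m. (- x) ^ Suc i * q ^ (Suc i choose 2) * w ^ (m - i) * qbin q m (Suc i))"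
    by (subst sum.atMost_Suc_shift) (simp add: qbin_0 [OF q_pow] binomial_eq_0)
  finally have 1: "(\<Sum>i\<le>m. ?c m i * w) = \<dots>" .
  have "(\<Sum>i\<le>Suc m. ?c (Suc m) i) = w ^ Suc m
      + (\<Sum>i\<le>m. (- x) ^ Suc i * q ^ (Suc i choose 2) * w ^ (m - i) * (qbin q m (Suc i) + q ^ (m - i) * qbin q m i))"
    by (subst sum.atMost_Suc_shift) (simp add: qbin_0 [OF q_pow] binomial_eq_0 qbin_Suc_Suc' [OF q_pow] del: power_Suc)
  also have "\<dots> = (\<Sum>i\<le>m. ?c m i * w)
      + (\<Sum>i\<le>m. (- x) ^ Suc i * q ^ (Suc i choose 2) * w ^ (m - i) * (q ^ (m - i) * qbin q m i))"
    unfolding 1 by (simp add: distrib_left sum.distrib del: power_Suc)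
  also have "(\<Sum>i\<le>m. (- x) ^ Suc i * q ^ (Suc i choose 2) * w ^ (m - i) * (q ^ (m - i) * qbin q m i))
      = (\<Sum>i\<le>m. ?c m i * (- x * q ^ m))"
  proof (rule sum.cong)
    fix i assume "i \<in> {..m}"
    then have "q ^ m = q ^ i * q ^ (m - i)" by (simp add: power_add [symmetric])
    moreover have "Suc i choose 2 = i + (i choose 2)" by (simp add: numeral_2_eq_2)
    ultimately show "(- x) ^ Suc i * q ^ (Suc i choose 2) * w ^ (m - i) * (q ^ (m - i) * qbin q m i)
      = ?c m i * (- x * q ^ m)"
      by (simp add: power_add)
  qed simp
  also have "(\<Sum>i\<le>m. ?c m i * w) + (\<Sum>i\<le>m. ?c m i * (- x * q ^ m)) = (\<Sum>i\<le>m. ?c m i) * (w - x * q ^ m)"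
    by (simp only: sum_distrib_right [symmetric] distrib_left [symmetric]) simp
  finally show ?case by (simp add: Suc.IH)
qed

text \<open>The homogeneous \<open>q\<close>-binomial theorem at \<open>w = q ^ Suc n\<close>, \<open>x = z\<close>: the terms \<open>n - r\<close> and
  \<open>Suc n + r\<close> are paired, and \<open>K\<close> below is their common factor.\<close>

lemma finite_jacobi_triple_product:
  fixes q :: "'a::field"
  assumes q_pow: "\<And>n. q ^ Suc n \<noteq> 1"
    and yz: "y * z = q" and q0: "q \<noteq> 0"
  shows "(\<Sum>r\<le>n. ((- z) ^ r * q ^ (r choose 2) + (- y) ^ Suc r * q ^ (Suc r choose 2))
       * qbin q (2 * n + 1) (n - r))
     = (\<Prod>i\<le>n. 1 - y * q ^ i) * (\<Prod>i<n. 1 - z * q ^ i)"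
proof -
  have z0: "z \<noteq> 0" using yz q0 by auto
  define K where "K = (- z) ^ Suc n * q ^ ((Suc n choose 2) + n * Suc n)"
  have K0: "K \<noteq> 0" using z0 q0 by (simp add: K_def)
  let ?c = "\<lambda>i. (- z) ^ i * q ^ (i choose 2) * (q ^ Suc n) ^ (2 * n + 1 - i) * qbin q (2 * n + 1) i"
  have add_choose: "(a + b) choose 2 = (a choose 2) + (b choose 2) + a * b" for a b :: nat
    by (induction b) (simp_all add: numeral_2_eq_2)
  have up: "?c (Suc n + r) = K * ((- z) ^ r * q ^ (r choose 2) * qbin q (2 * n + 1) (n - r))"
    if "r \<le> n" for r
  proof -
    obtain d where n: "n = r + d" using \<open>r \<le> n\<close> le_Suc_ex by blast
    have "2 * n + 1 - (Suc n + r) = d" by (simp add: n)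
    moreover have "((Suc n + r) choose 2) + Suc n * d = ((Suc n choose 2) + n * Suc n) + (r choose 2)"
      unfolding add_choose by (simp add: n algebra_simps)
    moreover have "qbin q (2 * n + 1) (Suc n + r) = qbin q (2 * n + 1) (n - r)"
      using qbin_symmetric [OF q_pow, of "n - r" "2 * n + 1"]
      by (simp add: n add_ac mult_2)
    ultimately show ?thesis
      by (simp add: K_def power_add [symmetric] power_mult [symmetric] del: power_Suc)
         (simp add: power_add algebra_simps)
  qed
  have down: "?c (n - r) = K * ((- y) ^ Suc r * q ^ (Suc r choose 2) * qbin q (2 * n + 1) (n - r))"
    if "r \<le> n" for r
  proof -
    obtain d where n: "n = r + d" using \<open>r \<le> n\<close> le_Suc_ex by blast
    have s: "Suc n = d + Suc r" by (simp add: n)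
    have zy: "(- z) ^ Suc n * (- y) ^ Suc r = (- z) ^ d * q ^ Suc r"
    proof -
      have "(- z) ^ Suc n * (- y) ^ Suc r = (- z) ^ d * ((- z) ^ Suc r * (- y) ^ Suc r)"
        unfolding s power_add by (simp only: mult.assoc)
      also have "(- z) ^ Suc r * (- y) ^ Suc r = q ^ Suc r"
        unfolding power_mult_distrib [symmetric] using yz by (simp add: mult.commute)
      finally show ?thesis .
    qed
    have e: "(d choose 2) + Suc n * (n + r + 1) = ((Suc n choose 2) + n * Suc n) + (Suc r choose 2) + Suc r"
    proof -
      have "2 * (Suc r choose 2) = Suc r * r" for r :: nat by (simp add: choose_two)
      from this[of r] show ?thesis unfolding s add_choose by (simp add: n algebra_simps)
    qed
    have "K * ((- y) ^ Suc r * q ^ (Suc r choose 2) * qbin q (2 * n + 1) (n - r))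
       = ((- z) ^ Suc n * (- y) ^ Suc r) * q ^ (((Suc n choose 2) + n * Suc n) + (Suc r choose 2))
           * qbin q (2 * n + 1) (n - r)"
      by (simp only: K_def power_add mult_ac)
    also have "\<dots> = (- z) ^ d * q ^ ((d choose 2) + Suc n * (n + r + 1)) * qbin q (2 * n + 1) (n - r)"
      unfolding zy e by (simp only: power_add mult_ac)
    also have "\<dots> = ?c (n - r)"
    proof -
      have "n - r = d" "2 * n + 1 - d = n + r + 1" by (simp_all add: n)
      then show ?thesis by (simp only: power_add power_mult mult.assoc)
    qed
    finally show ?thesis by (rule sym)
  qed
  \<comment> \<open>For \<open>l \<le> n\<close>, writing
    \<open>q ^ Suc n = q ^ l * q ^ (n - l) * (y * z)\<close> pulls out \<open>- z * q ^ l\<close>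
    and leaves the factors in \<open>y\<close>. The other factors give up \<open>q ^ Suc n\<close>
    and leave those in \<open>z\<close>.\<close>
  have "K * ((\<Prod>i\<le>n. 1 - y * q ^ i) * (\<Prod>i<n. 1 - z * q ^ i)) = (\<Prod>l<2 * n + 1. q ^ Suc n - z * q ^ l)"
  proof -
    have "(\<Prod>l<Suc n + n. q ^ Suc n - z * q ^ l)
       = (\<Prod>l<Suc n. q ^ Suc n - z * q ^ l) * (\<Prod>i<n. q ^ Suc n - z * q ^ (Suc n + i))"
    proof -
      have "(\<Prod>l<a + b. f l) = (\<Prod>l<a. f l) * (\<Prod>i<b. f (a + i))" for a b and f :: "nat \<Rightarrow> 'a"
        by (induction b) simp_all
      then show ?thesis .
    qed
    also have "(\<Prod>i<n. q ^ Suc n - z * q ^ (Suc n + i)) = (\<Prod>i<n. q ^ Suc n * (1 - z * q ^ i))"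
      by (simp add: power_add algebra_simps)
    also have "\<dots> = q ^ (n * Suc n) * (\<Prod>i<n. 1 - z * q ^ i)"
      by (simp only: prod.distrib prod_constant card_lessThan power_mult [symmetric] mult.commute)
    also have "(\<Prod>l<Suc n. q ^ Suc n - z * q ^ l) = (\<Prod>l<Suc n. (- z) * q ^ l * (1 - y * q ^ (n - l)))"
    proof (rule prod.cong)
      fix l assume "l \<in> {..<Suc n}"
      then have "q ^ Suc n = q ^ l * q ^ (n - l) * (y * z)"
        by (simp add: power_add [symmetric] yz)
      then show "q ^ Suc n - z * q ^ l = (- z) * q ^ l * (1 - y * q ^ (n - l))"
        by (simp only:) (simp add: algebra_simps)
    qed simp
    also have "\<dots> = (- z) ^ Suc n * q ^ (Suc n choose 2) * (\<Prod>l<Suc n. 1 - y * q ^ (n - l))"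
    proof -
      have "(\<Prod>l<m. q ^ l) = q ^ (m choose 2)" for m
        by (induction m) (simp_all add: numeral_2_eq_2 power_add)
      then show ?thesis by (simp only: prod.distrib prod_constant card_lessThan)
    qed
    also have "(\<Prod>l<Suc n. 1 - y * q ^ (n - l)) = (\<Prod>i\<le>n. 1 - y * q ^ i)"
      by (rule prod.reindex_bij_witness[of _ "\<lambda>r. n - r" "\<lambda>r. n - r"]) auto
    finally have "(\<Prod>l<Suc n + n. q ^ Suc n - z * q ^ l)
        = K * ((\<Prod>i\<le>n. 1 - y * q ^ i) * (\<Prod>i<n. 1 - z * q ^ i))"
      by (simp only: K_def power_add mult_ac)
    moreover have "Suc n + n = 2 * n + 1" by simp
    ultimately show ?thesis by (simp only:)
  qed
  also have "\<dots> = (\<Sum>i\<le>2 * n + 1. ?c i)"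
    by (rule q_binomial_theorem [OF q_pow])
  also have "\<dots> = (\<Sum>i\<le>n. ?c i) + (\<Sum>r\<le>n. ?c (Suc n + r))"
  proof -
    have "(\<Sum>i\<le>Suc a + b. f i) = (\<Sum>i\<le>a. f i) + (\<Sum>r\<le>b. f (Suc a + r))" for a b and f :: "nat \<Rightarrow> 'a"
      by (induction b) (simp_all add: add.assoc)
    from this[of ?c n n] show ?thesis by (simp only: mult_2 add_Suc add_Suc_right add_0_right One_nat_def)
  qed
  also have "(\<Sum>i\<le>n. ?c i) = (\<Sum>r\<le>n. ?c (n - r))"
    by (rule sum.reindex_bij_witness[of _ "\<lambda>r. n - r" "\<lambda>r. n - r"]) auto
  also have "(\<Sum>r\<le>n. ?c (n - r)) + (\<Sum>r\<le>n. ?c (Suc n + r))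
     = K * (\<Sum>r\<le>n. ((- z) ^ r * q ^ (r choose 2) + (- y) ^ Suc r * q ^ (Suc r choose 2))
       * qbin q (2 * n + 1) (n - r))"
  proof -
    have "(\<Sum>r\<le>n. ?c (n - r)) = (\<Sum>r\<le>n. K * ((- y) ^ Suc r * q ^ (Suc r choose 2) * qbin q (2 * n + 1) (n - r)))"
      by (rule sum.cong [OF refl], rule down) simp
    moreover have "(\<Sum>r\<le>n. ?c (Suc n + r)) = (\<Sum>r\<le>n. K * ((- z) ^ r * q ^ (r choose 2) * qbin q (2 * n + 1) (n - r)))"
      by (rule sum.cong [OF refl], rule up) simp
    ultimately show ?thesis
      by (simp only: sum.distrib [symmetric] sum_distrib_left) (simp only: distrib_left distrib_right add.commute)
  qed
  finally show ?thesis using K0 by simp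
qed

subsection \<open>The second Rogers-Ramanujan identity up to a given degree\<close>

lemma fps_to_fls_sum: "fps_to_fls (sum f S) = (\<Sum>x\<in>S. fps_to_fls (f x))"
  by (induction S rule: infinite_finite_induct) auto

lemma fps_to_fls_prod:
  fixes f :: "'b \<Rightarrow> 'a::comm_ring_1 fps"
  shows "fps_to_fls (prod f S) = (\<Prod>x\<in>S. fps_to_fls (f x))"
  by (induction S rule: infinite_finite_induct) (auto simp: fls_times_fps_to_fls)

lemma fps_to_fls_qfac:
  fixes f :: "'a::comm_ring_1 fps"
  shows "fps_to_fls (qfac f n) = qfac (fps_to_fls f) n"
  by (simp add: qfac_def fps_to_fls_prod fps_to_fls_power fls_times_fps_to_fls)

lemma fps_to_fls_inverse:
  fixes f :: "'a::field fps"
  shows "f $ 0 \<noteq> 0 \<Longrightarrow> fps_to_fls (inverse f) = inverse (fps_to_fls f)"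
  by (simp add: fls_inverse_fps_to_fls)

lemma fps_prod_nth_0: "prod f S $ 0 = (\<Prod>x\<in>S. f x $ 0 :: 'a::comm_ring_1)"
  by (induction S rule: infinite_finite_induct) auto

lemma qfac_nth_0 [simp]: "f $ 0 = 0 \<Longrightarrow> qfac f n $ 0 = (1 :: 'a::comm_ring_1)"
  by (induction n) (simp_all add: qfac_Suc fps_power_zeroth)

text \<open>Supplies the hypothesis that \<open>q\<close> is not a root of unity, for
  \<open>q\<close> a power of \<open>X\<close>; constant coefficients differ.\<close>

lemma fls_X_pow_neq_1: "d > 0 \<Longrightarrow> (fls_X ^ d) ^ Suc n \<noteq> (1 :: 'a::comm_ring_1 fls)"
proof
  assume "d > 0" and "(fls_X ^ d) ^ Suc n = (1 :: 'a fls)"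
  then have "fls_nth (fls_X ^ (d * Suc n)) 0 = fls_nth (1 :: 'a fls) 0"
    by (simp only: power_mult)
  then show False using \<open>d > 0\<close> by (simp del: mult_Suc_right)
qed

text \<open>The field identity is pulled back along the injective embedding into Laurent series,
  which respects these inverses because every \<open>qfac\<close> has constant term 1.\<close>

lemma fps_rogers_ramanujan_finite:
  "(\<Sum>r\<le>n. (-1) ^ r * fps_X ^ (5 * (r choose 2) + 4 * r) * (1 - fps_X ^ (2 * r + 1))
       * (inverse (qfac fps_X (n - r)) * inverse (qfac fps_X (n + r + 1))))
   = (\<Sum>s\<le>n. fps_X ^ (s * (s + 1)) * (inverse (qfac fps_X (n - s)) * inverse (qfac fps_X s)) :: 'a::field fps)"
  (is "?l = ?r")
proof -
  have "fps_to_fls ?l = fps_to_fls ?r"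
    using finite_rogers_ramanujan [of "fls_X :: 'a fls" n] fls_X_pow_neq_1 [of 1, where 'a = 'a]
    by (simp add: fps_to_fls_sum fls_times_fps_to_fls fps_to_fls_power fps_to_fls_inverse
         fps_to_fls_qfac divide_inverse mult.assoc)
  then show ?thesis by simp
qed

text \<open>The finite triple product with base \<open>X ^ 5\<close>, \<open>y = X\<close> and
  \<open>z = X ^ 4\<close>. The paired terms then combine into the factor
  \<open>1 - X ^ (2 * r + 1)\<close>, so the numerators are those of the finite Rogers-Ramanujan
  identity.\<close>

lemma fps_jacobi_triple_product_finite:
  "qfac (fps_X ^ 5) (2 * n + 1) *
     (\<Sum>r\<le>n. (-1) ^ r * fps_X ^ (5 * (r choose 2) + 4 * r) * (1 - fps_X ^ (2 * r + 1))
       * (inverse (qfac (fps_X ^ 5) (n - r)) * inverse (qfac (fps_X ^ 5) (n + r + 1))))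
   = ((\<Prod>i\<le>n. 1 - fps_X ^ (5 * i + 1)) * (\<Prod>i<n. 1 - fps_X ^ (5 * i + 4)) :: 'a::field fps)"
  (is "?l = ?r")
proof -
  let ?X = "fls_X :: 'a fls"
  have coeff: "((- (?X ^ 4)) ^ r * (?X ^ 5) ^ (r choose 2) + (- ?X) ^ Suc r * (?X ^ 5) ^ (Suc r choose 2))
       * qbin (?X ^ 5) (2 * n + 1) (n - r)
     = qfac (?X ^ 5) (2 * n + 1) * ((-1) ^ r * ?X ^ (5 * (r choose 2) + 4 * r) * (1 - ?X ^ (2 * r + 1))
       * (inverse (qfac (?X ^ 5) (n - r)) * inverse (qfac (?X ^ 5) (n + r + 1))))" if "r \<le> n" for r
  proof -
    have "(- (?X ^ 4)) ^ r * (?X ^ 5) ^ (r choose 2) = (-1) ^ r * ?X ^ (5 * (r choose 2) + 4 * r)"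
      by (subst power_minus) (simp add: power_add power_mult [symmetric] mult_ac)
    moreover have "(- ?X) ^ Suc r * (?X ^ 5) ^ (Suc r choose 2)
        = (-1) ^ r * ?X ^ (5 * (r choose 2) + 4 * r) * (- (?X ^ (2 * r + 1)))"
    proof -
      have "(- ?X) ^ Suc r * (?X ^ 5) ^ (Suc r choose 2) = (-1) ^ Suc r * (?X ^ Suc r * ?X ^ (5 * (Suc r choose 2)))"
        by (subst power_minus) (simp only: power_mult mult.assoc)
      also have "?X ^ Suc r * ?X ^ (5 * (Suc r choose 2)) = ?X ^ (5 * (r choose 2) + 4 * r) * ?X ^ (2 * r + 1)"
        unfolding power_add [symmetric] Suc_choose_2 by (rule arg_cong [of _ _ "\<lambda>i. ?X ^ i"]) simp
      finally show ?thesis by simp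
    qed
    moreover have "2 * n + 1 - (n - r) = n + r + 1" using that by simp
    ultimately show ?thesis
      by (simp add: qbin_def divide_inverse algebra_simps)
  qed
  have yz: "?X * ?X ^ 4 = ?X ^ 5" by (simp add: eval_nat_numeral)
  have "fps_to_fls ?l = (\<Sum>r\<le>n. ((- (?X ^ 4)) ^ r * (?X ^ 5) ^ (r choose 2)
           + (- ?X) ^ Suc r * (?X ^ 5) ^ (Suc r choose 2)) * qbin (?X ^ 5) (2 * n + 1) (n - r))"
    using coeff
    by (simp add: fps_to_fls_sum fls_times_fps_to_fls fps_to_fls_power fps_to_fls_inverse
         fps_to_fls_qfac sum_distrib_left del: add_Suc add_Suc_right mult_Suc power_Suc One_nat_def)
  also have "\<dots> = (\<Prod>i\<le>n. 1 - ?X * (?X ^ 5) ^ i) * (\<Prod>i<n. 1 - ?X ^ 4 * (?X ^ 5) ^ i)"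
    by (rule finite_jacobi_triple_product [OF fls_X_pow_neq_1 yz]) simp_all
  also have "\<dots> = fps_to_fls ?r"
    by (simp add: fps_to_fls_prod fls_times_fps_to_fls fps_to_fls_power power_add power_mult [symmetric] mult_ac)
  finally show ?thesis by simp
qed

section \<open>Congruence of power series modulo \<open>X ^ (N + 1)\<close>\<close>

definition fps_eq_upto :: "nat \<Rightarrow> 'a fps \<Rightarrow> 'a fps \<Rightarrow> bool" where
  "fps_eq_upto N f g \<longleftrightarrow> (\<forall>i\<le>N. f $ i = g $ i)"

lemma fps_eq_upto_refl [simp, intro]: "fps_eq_upto N f f"
  by (simp add: fps_eq_upto_def)

lemma fps_eq_upto_sym: "fps_eq_upto N f g \<Longrightarrow> fps_eq_upto N g f"
  by (simp add: fps_eq_upto_def)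

lemma fps_eq_upto_trans [trans]: "fps_eq_upto N f g \<Longrightarrow> fps_eq_upto N g h \<Longrightarrow> fps_eq_upto N f h"
  by (simp add: fps_eq_upto_def)

lemma fps_eq_upto_diff:
  "fps_eq_upto N f f' \<Longrightarrow> fps_eq_upto N g g' \<Longrightarrow> fps_eq_upto N (f - g) (f' - g' :: 'a::ab_group_add fps)"
  by (simp add: fps_eq_upto_def)

lemma fps_eq_upto_mult:
  "fps_eq_upto N f f' \<Longrightarrow> fps_eq_upto N g g' \<Longrightarrow> fps_eq_upto N (f * g) (f' * g' :: 'a::comm_ring_1 fps)"
  by (auto simp: fps_eq_upto_def fps_mult_nth intro!: sum.cong)

text \<open>Used to exchange the denominators of terms whose numerator already vanishes up to degree
  \<open>N\<close>.\<close>

lemma fps_eq_upto_mult_null: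
  fixes f :: "'a::comm_ring_1 fps"
  assumes "fps_eq_upto N f 0"
  shows "fps_eq_upto N (f * g) (f * h)"
proof -
  have "fps_eq_upto N (f * b) (0 * b)" for b
    by (rule fps_eq_upto_mult [OF assms fps_eq_upto_refl])
  from this [of g] this [of h] show ?thesis by (simp add: fps_eq_upto_def)
qed

lemma fps_eq_upto_sum:
  "(\<And>x. x \<in> S \<Longrightarrow> fps_eq_upto N (f x) (g x)) \<Longrightarrow> fps_eq_upto N (sum f S) (sum g S :: 'a::comm_ring_1 fps)"
  by (auto simp: fps_eq_upto_def fps_sum_nth intro!: sum.cong)

lemma fps_eq_upto_X_power: "k > N \<Longrightarrow> fps_eq_upto N (fps_X ^ k) (0 :: 'a::comm_ring_1 fps)"
  by (auto simp: fps_eq_upto_def)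

lemma fps_eq_upto_cancel:
  fixes c f g :: "'a::field fps"
  assumes "fps_eq_upto N (c * f) (c * g)" and "c $ 0 \<noteq> 0"
  shows "fps_eq_upto N f g"
proof -
  have "fps_eq_upto N (inverse c * (c * f)) (inverse c * (c * g))"
    by (rule fps_eq_upto_mult [OF fps_eq_upto_refl assms(1)])
  moreover have "inverse c * (c * h) = h" for h
    using inverse_mult_eq_1 [OF assms(2)] by (metis mult.assoc mult_1_left)
  ultimately show ?thesis by simp
qed

lemma fps_eq_upto_inverse:
  fixes f g :: "'a::field fps"
  assumes "fps_eq_upto N f g" and "g $ 0 \<noteq> 0"
  shows "fps_eq_upto N (inverse f) (inverse g)"
proof (rule fps_eq_upto_cancel)
  have "f $ 0 = g $ 0" using assms by (auto simp: fps_eq_upto_def)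
  then have "g * inverse g = f * inverse f"
    using assms(2) by (simp add: inverse_mult_eq_1')
  moreover have "fps_eq_upto N (g * inverse f) (f * inverse f)"
    using assms(1) by (intro fps_eq_upto_mult fps_eq_upto_sym [OF assms(1)]) auto
  ultimately show "fps_eq_upto N (g * inverse f) (g * inverse g)" by simp
qed fact

text \<open>All factors beyond the \<open>N\<close>-th differ from 1 only in degrees above
  \<open>N\<close>.\<close>

lemma qfac_eq_upto:
  assumes "N \<le> n" and "d > 0"
  shows "fps_eq_upto N (qfac (fps_X ^ d) n) (qfac (fps_X ^ d) N :: 'a::comm_ring_1 fps)"
  using assms(1)
proof (induction n rule: dec_induct)
  case (step n)
  have "N < 1 * Suc n" using step.hyps by simp
  also have "\<dots> \<le> d * Suc n" using \<open>d > 0\<close> by (intro mult_le_mono1) simp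
  finally have "N < d * Suc n" .
  then have "fps_eq_upto N ((fps_X ^ d) ^ Suc n) (0 :: 'a fps)"
    unfolding power_mult [symmetric] by (rule fps_eq_upto_X_power)
  then have "fps_eq_upto N (qfac (fps_X ^ d) (Suc n)) (qfac (fps_X ^ d) N * (1 - 0) :: 'a fps)"
    unfolding qfac_Suc by (intro fps_eq_upto_mult fps_eq_upto_diff step.IH) auto
  then show ?case by simp
qed simp

text \<open>The factors are sorted by the residue of their exponent modulo 5; the multiples of 5
  form the \<open>qfac\<close> with base \<open>X ^ 5\<close>.\<close>

lemma qfac_fps_X_mult_5:
  "qfac fps_X (5 * n) = qfac (fps_X ^ 5) n * (\<Prod>i<n. 1 - fps_X ^ (5 * i + 1))
      * (\<Prod>i<n. 1 - fps_X ^ (5 * i + 2)) * (\<Prod>i<n. 1 - fps_X ^ (5 * i + 3))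
      * (\<Prod>i<n. (1 - fps_X ^ (5 * i + 4)) :: 'a::comm_ring_1 fps)"
proof (induction n)
  case (Suc n)
  have "5 * Suc n = Suc (Suc (Suc (Suc (Suc (5 * n)))))" by simp
  then have "qfac fps_X (5 * Suc n) = (qfac fps_X (5 * n) :: 'a fps) * (1 - fps_X ^ (5 * n + 1))
      * (1 - fps_X ^ (5 * n + 2)) * (1 - fps_X ^ (5 * n + 3)) * (1 - fps_X ^ (5 * n + 4))
      * (1 - fps_X ^ (5 * Suc n))"
    by (simp only: qfac_Suc) (simp only: add_numeral_left numeral_eq_Suc pred_numeral_simps BitM.simps add_Suc_right add_0_right One_nat_def)
  then show ?case
    unfolding Suc.IH by (simp only: qfac_Suc prod.lessThan_Suc power_mult [symmetric] mult_ac)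
qed simp

text \<open>Both finite identities contain the theta sum \<open>T\<close>. Modulo
  \<open>X ^ (N + 1)\<close> one equates it with \<open>qfac fps_X N\<close> times the sum side, the
  other with the product over the residues 0, 1 and 4 modulo 5. Cancelling these classes from
  \<open>qfac fps_X N\<close> leaves the residues 2 and 3.\<close>

theorem rogers_ramanujan_2_upto:
  fixes N n :: nat
  assumes "n \<ge> 2 * N"
  shows "fps_eq_upto N (\<Sum>s\<le>n. fps_X ^ (s * (s + 1)) * inverse (qfac fps_X s))
     (inverse ((\<Prod>i\<le>n. 1 - fps_X ^ (5 * i + 2)) * (\<Prod>i\<le>n. 1 - fps_X ^ (5 * i + 3))) :: 'a::field fps)"
proof -
  let ?R = "\<Sum>s\<le>n. fps_X ^ (s * (s + 1)) * inverse (qfac fps_X s) :: 'a fps"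
  let ?q = "qfac fps_X :: nat \<Rightarrow> 'a fps" and ?Q = "qfac (fps_X ^ 5) :: nat \<Rightarrow> 'a fps"
  define a where "a r = ((-1) ^ r * fps_X ^ (5 * (r choose 2) + 4 * r) * (1 - fps_X ^ (2 * r + 1)) :: 'a fps)" for r
  define T where "T = (\<Sum>r\<le>n. a r)"
  define P where "P b = (\<Prod>i\<le>n. 1 - fps_X ^ (5 * i + b) :: 'a fps)" for b
  have a_small: "fps_eq_upto N (a r) 0" if "r > N" for r
  proof -
    have "fps_eq_upto N (a r) ((-1) ^ r * 0 * (1 - fps_X ^ (2 * r + 1)))"
      unfolding a_def using that by (intro fps_eq_upto_mult fps_eq_upto_X_power) auto
    then show ?thesis by simp
  qed
  \<comment> \<open>Applied with \<open>d = 1\<close> to the sum side and with \<open>d = 5\<close>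
    to the product side.\<close>
  have sum_a: "fps_eq_upto N (\<Sum>r\<le>n. a r * (inverse (qfac (fps_X ^ d) (n - r)) * inverse (qfac (fps_X ^ d) (n + r + 1))))
      (T * (inverse (qfac (fps_X ^ d) N) * inverse (qfac (fps_X ^ d) N)))" if "d > 0" for d
    unfolding T_def sum_distrib_right
  proof (rule fps_eq_upto_sum)
    fix r assume "r \<in> {..n}"
    show "fps_eq_upto N (a r * (inverse (qfac (fps_X ^ d) (n - r)) * inverse (qfac (fps_X ^ d) (n + r + 1))))
       (a r * (inverse (qfac (fps_X ^ d) N) * inverse (qfac (fps_X ^ d) N)))"
    proof (cases "r \<le> N")
      case True
      \<comment> \<open>The bound \<open>n \<ge> 2 * N\<close> enters here:
        \<open>n - r \<ge> N\<close> whenever \<open>r \<le> N\<close>.\<close>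
      with assms \<open>d > 0\<close> show ?thesis
        by (intro fps_eq_upto_mult fps_eq_upto_inverse qfac_eq_upto) (auto simp: fps_power_zeroth)
    next
      case False
      then show ?thesis by (intro fps_eq_upto_mult_null a_small) simp
    qed
  qed
  have inv: "?q i * inverse (?q i) = 1" "?Q i * inverse (?Q i) = 1" for i
    by (rule inverse_mult_eq_1', simp add: fps_power_zeroth)+
  have RT: "fps_eq_upto N (?q N * ?R) T"
  proof (rule fps_eq_upto_cancel)
    have "fps_eq_upto N (\<Sum>s\<le>n. fps_X ^ (s * (s + 1)) * (inverse (?q (n - s)) * inverse (?q s)))
        (\<Sum>s\<le>n. inverse (?q N) * (fps_X ^ (s * (s + 1)) * inverse (?q s)))"
    proof (rule fps_eq_upto_sum)
      fix s assume "s \<in> {..n}"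
      show "fps_eq_upto N (fps_X ^ (s * (s + 1)) * (inverse (?q (n - s)) * inverse (?q s)))
          (inverse (?q N) * (fps_X ^ (s * (s + 1)) * inverse (?q s)))"
      proof (cases "s \<le> N")
        case True
        with assms have "fps_eq_upto N (?q (n - s)) (?q N)"
          using qfac_eq_upto [of N "n - s" 1, where 'a = 'a] by simp
        then have "fps_eq_upto N (fps_X ^ (s * (s + 1)) * (inverse (?q (n - s)) * inverse (?q s)))
            (fps_X ^ (s * (s + 1)) * (inverse (?q N) * inverse (?q s)))"
          by (intro fps_eq_upto_mult fps_eq_upto_inverse) auto
        then show ?thesis by (simp only: mult_ac)
      next
        case False
        then have "N < s * (s + 1)" by (simp add: less_le_trans[of N s])
        then show ?thesis
          unfolding mult.left_commute [of "inverse (?q N)"]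
          by (intro fps_eq_upto_mult_null fps_eq_upto_X_power)
      qed
    qed
    also have "(\<Sum>s\<le>n. inverse (?q N) * (fps_X ^ (s * (s + 1)) * inverse (?q s))) = inverse (?q N) * ?R"
      by (simp only: sum_distrib_left)
    also have "(\<Sum>s\<le>n. fps_X ^ (s * (s + 1)) * (inverse (?q (n - s)) * inverse (?q s)))
       = (\<Sum>r\<le>n. a r * (inverse (?q (n - r)) * inverse (?q (n + r + 1))))"
      unfolding a_def by (rule fps_rogers_ramanujan_finite [symmetric])
    finally have "fps_eq_upto N (inverse (?q N) * ?R) (T * (inverse (?q N) * inverse (?q N)))"
      using fps_eq_upto_trans [OF fps_eq_upto_sym] sum_a [of 1] by simp
    then have "fps_eq_upto N (inverse (?q N) * ?R) (inverse (?q N) * (T * inverse (?q N)))"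
      by (simp only: mult_ac)
    also have "inverse (?q N) * ?R = inverse (?q N) * ?R * (?q N * inverse (?q N))"
      by (simp only: inv mult_1_right)
    also have "\<dots> = inverse (?q N) * inverse (?q N) * (?q N * ?R)"
      by (simp only: mult_ac)
    also have "inverse (?q N) * (T * inverse (?q N)) = inverse (?q N) * inverse (?q N) * T"
      by (simp only: mult_ac)
    finally show "fps_eq_upto N (inverse (?q N) * inverse (?q N) * (?q N * ?R)) (inverse (?q N) * inverse (?q N) * T)" .
    show "(inverse (?q N) * inverse (?q N)) $ 0 \<noteq> 0" by simp
  qed
  have TQ: "fps_eq_upto N T (?Q N * (P 1 * (\<Prod>i<n. 1 - fps_X ^ (5 * i + 4))))"
  proof -
    have "fps_eq_upto N (?Q (2 * n + 1) * (\<Sum>r\<le>n. a r * (inverse (?Q (n - r)) * inverse (?Q (n + r + 1)))))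
       (?Q N * (T * (inverse (?Q N) * inverse (?Q N))))"
      using assms by (intro fps_eq_upto_mult sum_a qfac_eq_upto) auto
    also have "?Q (2 * n + 1) * (\<Sum>r\<le>n. a r * (inverse (?Q (n - r)) * inverse (?Q (n + r + 1))))
      = P 1 * (\<Prod>i<n. 1 - fps_X ^ (5 * i + 4))"
      unfolding a_def P_def by (rule fps_jacobi_triple_product_finite)
    also have "?Q N * (T * (inverse (?Q N) * inverse (?Q N))) = T * inverse (?Q N) * (?Q N * inverse (?Q N))"
      by (simp only: mult_ac)
    finally have "fps_eq_upto N (P 1 * (\<Prod>i<n. 1 - fps_X ^ (5 * i + 4))) (T * inverse (?Q N))"
      by (simp add: inv)
    then have "fps_eq_upto N (?Q N * (P 1 * (\<Prod>i<n. 1 - fps_X ^ (5 * i + 4)))) (?Q N * (T * inverse (?Q N)))"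
      by (rule fps_eq_upto_mult [OF fps_eq_upto_refl])
    also have "?Q N * (T * inverse (?Q N)) = T * (?Q N * inverse (?Q N))" by (simp only: mult_ac)
    finally show ?thesis by (simp add: inv fps_eq_upto_sym)
  qed
  \<comment> \<open>The finite triple product has one factor fewer in residue class 4 than in class
    1; the missing one has exponent \<open>5 * n + 4 > N\<close>.\<close>
  have P4: "fps_eq_upto N (\<Prod>i<n. 1 - fps_X ^ (5 * i + 4)) (P 4)"
  proof -
    have "fps_eq_upto N (P 4) ((\<Prod>i<n. 1 - fps_X ^ (5 * i + 4)) * (1 - 0))"
      unfolding P_def lessThan_Suc_atMost [symmetric] prod.lessThan_Suc using assms
      by (intro fps_eq_upto_mult fps_eq_upto_diff fps_eq_upto_X_power) auto
    then show ?thesis by (simp add: fps_eq_upto_sym)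
  qed
  have qP: "fps_eq_upto N (?q N) (?Q N * P 1 * P 2 * P 3 * P 4)"
  proof -
    have "fps_eq_upto N (?q N) (?q (5 * Suc n))"
      using qfac_eq_upto [of N "5 * Suc n" 1, where 'a = 'a] assms by (simp add: fps_eq_upto_sym)
    also have "?q (5 * Suc n) = ?Q (Suc n) * P 1 * P 2 * P 3 * P 4"
      unfolding P_def lessThan_Suc_atMost [symmetric] by (rule qfac_fps_X_mult_5)
    also have "fps_eq_upto N \<dots> (?Q N * P 1 * P 2 * P 3 * P 4)"
      using assms by (intro fps_eq_upto_mult qfac_eq_upto) auto
    finally show ?thesis .
  qed
  have P0: "P b $ 0 = 1" if "b > 0" for b
    using that unfolding P_def by (subst fps_prod_nth_0) auto
  have "fps_eq_upto N (?Q N * P 1 * P 4 * (P 2 * P 3 * ?R)) (?Q N * P 1 * P 4 * 1)"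
  proof -
    have "fps_eq_upto N (?Q N * P 1 * P 2 * P 3 * P 4 * ?R) (?q N * ?R)"
      by (intro fps_eq_upto_mult fps_eq_upto_sym [OF qP]) auto
    also note RT
    also note TQ
    also have "fps_eq_upto N (?Q N * (P 1 * (\<Prod>i<n. 1 - fps_X ^ (5 * i + 4)))) (?Q N * (P 1 * P 4))"
      by (intro fps_eq_upto_mult P4) auto
    finally show ?thesis unfolding mult_1_right by (simp only: mult_ac)
  qed
  then have "fps_eq_upto N (P 2 * P 3 * ?R) 1"
    by (rule fps_eq_upto_cancel) (simp add: P0 fps_power_zeroth)
  also have "1 = P 2 * P 3 * inverse (P 2 * P 3)"
    by (rule inverse_mult_eq_1' [symmetric]) (simp add: P0)
  finally show ?thesis
    unfolding P_def [symmetric] by (rule fps_eq_upto_cancel) (simp add: P0)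
qed

subsection \<open>Multiplicity functions and generating functions\<close>


text \<open>Partitions as multiplicity functions, with the multiplicity of \<open>i\<close>
  restricted to \<open>C i\<close>. The value 0 outside \<open>S\<close> makes the function
  unique.\<close>

definition mults :: "nat set \<Rightarrow> (nat \<Rightarrow> nat set) \<Rightarrow> nat \<Rightarrow> (nat \<Rightarrow> nat) set" where
  "mults S C n = {f. (\<forall>i. i \<notin> S \<longrightarrow> f i = 0) \<and> (\<forall>i\<in>S. f i \<in> C i) \<and> (\<Sum>i\<in>S. i * f i) = n}"

text \<open>For \<open>i > 0\<close> this is the sum of \<open>X ^ (i * c)\<close> over
  \<open>c\<close> in \<open>D\<close>; giving the coefficients directly also covers infinite
  \<open>D\<close>.\<close>

definition part_gf :: "nat \<Rightarrow> nat set \<Rightarrow> rat fps" where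
  "part_gf i D = Abs_fps (\<lambda>n. if n \<in> (*) i ` D then 1 else 0)"

text \<open>Splitting off the multiplicity of one part size corresponds to splitting one factor off
  the product of generating functions.\<close>

lemma mults_insert_bij:
  assumes "finite S" and "p \<notin> S" and "p > 0"
  shows "bij_betw (\<lambda>f. (f p, f(p := 0))) (mults (insert p S) C n)
           (SIGMA c:{c \<in> C p. p * c \<le> n}. mults S C (n - p * c))"
proof (rule bij_betw_byWitness [where f' = "\<lambda>(c, g). g(p := c)"])
  have upd: "(\<Sum>i\<in>S. i * (f(p := c)) i) = (\<Sum>i\<in>S. i * f i)" for f c
    using assms(2) by (intro sum.cong) auto
  show "\<forall>f\<in>mults (insert p S) C n. (\<lambda>(c, g). g(p := c)) (f p, f(p := 0)) = f"
    by auto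
  show "\<forall>x\<in>SIGMA c:{c \<in> C p. p * c \<le> n}. mults S C (n - p * c).
      (((\<lambda>(c, g). g(p := c)) x) p, ((\<lambda>(c, g). g(p := c)) x)(p := 0)) = x"
    using assms(2) by (auto simp: mults_def)
  show "(\<lambda>f. (f p, f(p := 0))) ` mults (insert p S) C n \<subseteq> (SIGMA c:{c \<in> C p. p * c \<le> n}. mults S C (n - p * c))"
    using assms upd by (auto simp: mults_def)
  show "(\<lambda>(c, g). g(p := c)) ` (SIGMA c:{c \<in> C p. p * c \<le> n}. mults S C (n - p * c)) \<subseteq> mults (insert p S) C n"
    using assms upd by (auto simp: mults_def)
qed

lemma card_mults:
  assumes "finite S" and "0 \<notin> S"
  shows "finite (mults S C n) \<and> of_nat (card (mults S C n)) = (\<Prod>i\<in>S. part_gf i (C i)) $ n"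
  using assms
proof (induction S arbitrary: n rule: finite_induct)
  case empty
  have "mults {} C n = (if n = 0 then {\<lambda>_. 0} else {})"
    by (auto simp: mults_def)
  then show ?case by simp
next
  case (insert p S)
  let ?G = "\<Prod>i\<in>S. part_gf i (C i)"
  let ?D = "{c \<in> C p. p * c \<le> n}"
  have p: "p > 0" and IH: "finite (mults S C m)" "of_nat (card (mults S C m)) = ?G $ m" for m
    using insert by (auto intro: Nat.gr0I)
  note bij = mults_insert_bij [OF insert.hyps p, of C n]
  have "?D \<subseteq> {..n}"
  proof
    fix c assume "c \<in> ?D"
    then have "p * c \<le> n" by simp
    moreover have "c \<le> p * c" using p by (cases p) simp_all
    ultimately show "c \<in> {..n}" using le_trans by blast
  qed
  then have fin: "finite ?D" by (rule finite_subset) simp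
  have "finite (SIGMA c:?D. mults S C (n - p * c))"
    using fin IH(1) by (rule finite_SigmaI)
  then have "finite (mults (insert p S) C n)"
    using bij_betw_finite [OF bij] by simp
  moreover have "of_nat (card (mults (insert p S) C n)) = (\<Sum>c\<in>?D. ?G $ (n - p * c))"
    using bij_betw_same_card [OF bij] fin IH by (simp add: card_SigmaI)
  moreover have "(\<Sum>c\<in>?D. ?G $ (n - p * c)) = (part_gf p (C p) * ?G) $ n"
  proof -
    have "(part_gf p (C p) * ?G) $ n = (\<Sum>i\<in>{0..n}. if i \<in> (*) p ` C p then ?G $ (n - i) else 0)"
      unfolding fps_mult_nth by (intro sum.cong) (auto simp: part_gf_def)
    also have "\<dots> = (\<Sum>i\<in>{0..n} \<inter> (*) p ` C p. ?G $ (n - i))"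
      by (simp add: sum.inter_restrict)
    also have "{0..n} \<inter> (*) p ` C p = (*) p ` ?D"
      by auto
    also have "(\<Sum>i\<in>(*) p ` ?D. ?G $ (n - i)) = (\<Sum>c\<in>?D. ?G $ (n - p * c))"
      using p by (subst sum.reindex) (auto simp: inj_on_def)
    finally show ?thesis ..
  qed
  ultimately show ?case
    using insert.hyps by simp
qed

lemma part_gf_finite:
  assumes "finite D" and "i > 0"
  shows "part_gf i D = (\<Sum>c\<in>D. fps_X ^ (i * c))"
proof (rule fps_ext)
  fix n
  have "(\<Sum>c\<in>D. fps_X ^ (i * c)) $ n = (\<Sum>c\<in>D. if n = i * c then 1 else (0 :: rat))"
    by (simp add: fps_sum_nth)
  also have "\<dots> = (\<Sum>m\<in>(*) i ` D. if n = m then 1 else 0)"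
    using assms(2) by (subst sum.reindex) (auto simp: inj_on_def)
  also have "\<dots> = (if n \<in> (*) i ` D then 1 else 0)"
    using assms(1) by simp
  finally show "part_gf i D $ n = (\<Sum>c\<in>D. fps_X ^ (i * c)) $ n"
    by (simp add: part_gf_def)
qed

lemma part_gf_singleton: "i > 0 \<Longrightarrow> part_gf i {c} = fps_X ^ (i * c)"
  by (simp add: part_gf_finite)

lemma part_gf_UNIV:
  assumes "i > 0"
  shows "part_gf i UNIV = inverse (1 - fps_X ^ i)"
proof -
  have "part_gf i UNIV * (1 - fps_X ^ i) = 1"
  proof (rule fps_ext)
    fix n
    have "n \<in> (*) i ` UNIV \<longleftrightarrow> i dvd n" for n by (auto simp: dvd_def)
    then have "(part_gf i UNIV * (1 - fps_X ^ i)) $ n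
        = (if i dvd n then 1 else 0) - (if n < i then 0 else if i dvd n - i then 1 else 0)"
      by (simp add: right_diff_distrib fps_X_power_mult_right_nth part_gf_def)
    also have "\<dots> = (1 :: rat fps) $ n"
      using assms by (auto dest: dvd_imp_le simp: dvd_minus_self)
    finally show "(part_gf i UNIV * (1 - fps_X ^ i)) $ n = (1 :: rat fps) $ n" .
  qed
  then show ?thesis
    by (metis fps_inverse_unique mult.commute)
qed

text \<open>A decreasing list is determined by its multiplicities, and sorting the multiset with
  given multiplicities recovers it.\<close>

lemma card_partitions:
  assumes "finite S" and "0 \<notin> S"
  shows "of_nat (card {xs. is_partition_of xs n \<and> set xs \<subseteq> S \<and> (\<forall>i\<in>S. count_list xs i \<in> C i)})
       = (\<Prod>i\<in>S. part_gf i (C i)) $ n"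
proof -
  let ?L = "{xs. is_partition_of xs n \<and> set xs \<subseteq> S \<and> (\<forall>i\<in>S. count_list xs i \<in> C i)}"
  have sum: "sum_list xs = (\<Sum>i\<in>S. i * count_list xs i)" if "set xs \<subseteq> S" for xs
    using sum_list_map_eq_sum_count2 [OF that assms(1), of "\<lambda>x. x"] by (simp add: mult.commute)
  have inj: "inj_on count_list ?L"
  proof (rule inj_onI)
    fix xs ys assume xs: "xs \<in> ?L" and ys: "ys \<in> ?L" and eq: "count_list xs = count_list ys"
    then have "mset xs = mset ys" by (intro multiset_eqI) (simp add: count_mset)
    moreover have "sorted (rev xs)" "sorted (rev ys)"
      using xs ys by (auto simp: is_partition_of_def is_partition_def sorted_wrt_rev)
    ultimately have "rev xs = rev ys"
      by (metis mset_rev properties_for_sort)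
    then show "xs = ys" by simp
  qed
  have "count_list ` ?L = mults S C n"
  proof (rule set_eqI, rule iffI)
    fix f assume "f \<in> count_list ` ?L"
    then show "f \<in> mults S C n"
      using sum by (auto simp: mults_def is_partition_of_def count_list_0_iff)
  next
    fix f assume f: "f \<in> mults S C n"
    define A where "A = (\<Sum>i\<in>S. replicate_mset (f i) i)"
    define xs where "xs = rev (sorted_list_of_multiset A)"
    have A: "count A i = f i" for i
    proof -
      have "count A i = (\<Sum>l\<in>S. if l = i then f l else 0)"
        unfolding A_def by (simp add: count_sum) (intro sum.cong, auto)
      then show ?thesis using assms(1) f by (auto simp: mults_def)
    qed
    have "mset xs = A" by (simp add: xs_def)
    then have count: "count_list xs = f" using A by (auto simp: count_mset [symmetric] fun_eq_iff)
    have "set xs = set_mset A" by (simp add: xs_def)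
    also have "\<dots> \<subseteq> S" using A f by (auto simp: mults_def set_mset_def)
    finally have "set xs \<subseteq> S" .
    moreover have "sorted_wrt (\<ge>) xs" by (simp add: xs_def sorted_wrt_rev)
    ultimately have "xs \<in> ?L"
      using f sum [of xs] assms(2) by (auto simp: mults_def is_partition_of_def is_partition_def count intro: Nat.gr0I)
    then show "f \<in> count_list ` ?L" using count by blast
  qed
  then have "card ?L = card (mults S C n)"
    using card_image [OF inj] by simp
  then show ?thesis using card_mults [OF assms] by simp
qed

subsection \<open>Columns of partitions with differences at least two\<close>

text \<open>In a decreasing list the entries above \<open>c\<close> form an initial segment.\<close>

lemma less_length_filter_sorted:
  "sorted_wrt (\<ge>) ys \<Longrightarrow> i < length (filter (\<lambda>p. c < p) ys) \<longleftrightarrow> i < length ys \<and> c < ys ! i"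
  for c :: "'a::linorder"
proof (induction ys arbitrary: i)
  case (Cons y ys)
  show ?case
  proof (cases "c < y")
    case True
    then show ?thesis using Cons by (cases i) auto
  next
    case False
    then have "\<forall>p\<in>set (y # ys). \<not> c < p" using Cons.prems by auto
    then show ?thesis by (metis filter_False length_0_conv not_less0 nth_mem)
  qed
qed simp

text \<open>Zeros lie in no column and stand at the end of the list, so neither the column lengths
  nor the number of columns change.\<close>

lemma conjugate_filter_nonzero:
  assumes "sorted_wrt (\<ge>) ys"
  shows "conjugate (filter (\<lambda>p. p \<noteq> 0) ys) = conjugate ys"
proof -
  have "filter (\<lambda>p. c < p) (filter (\<lambda>p. p \<noteq> 0) ys) = filter (\<lambda>p. c < p) ys" for c :: nat
    by (auto simp: filter_filter intro: filter_cong)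
  moreover have "(if filter (\<lambda>p. p \<noteq> 0) ys = [] then 0 else hd (filter (\<lambda>p. p \<noteq> 0) ys))
      = (if ys = [] then 0 else hd ys)"
    using assms by (cases ys) (auto simp: filter_empty_conv)
  ultimately show ?thesis by (simp only: conjugate_def)
qed

text \<open>Column \<open>c\<close> has length \<open>Suc i\<close> exactly when row
  \<open>i\<close> reaches beyond \<open>c\<close> and row \<open>Suc i\<close> does not, with
  missing rows read as 0.\<close>

lemma count_list_conjugate:
  assumes sorted: "sorted_wrt (\<ge>) ys"
  shows "count_list (conjugate ys) (Suc i)
    = (if i < length ys then ys ! i else 0) - (if Suc i < length ys then ys ! Suc i else 0)"
proof -
  let ?a = "\<lambda>i. if i < length ys then ys ! i else 0"
  let ?g = "\<lambda>c. length (filter (\<lambda>p. c < p) ys)"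
  define h where "h = (if ys = [] then 0 else hd ys)"
  have g: "?g c = Suc i \<longleftrightarrow> c < ?a i \<and> \<not> c < ?a (Suc i)" for c
    using less_length_filter_sorted [OF sorted, of i c] less_length_filter_sorted [OF sorted, of "Suc i" c]
    by auto
  have h: "?a i \<le> h"
    using sorted by (auto simp: h_def sorted_wrt_iff_nth_less hd_conv_nth) (metis le_eq_less_or_eq neq0_conv)
  have "count_list (conjugate ys) (Suc i) = card {c. c < h \<and> ?g c = Suc i}"
    unfolding conjugate_def h_def [symmetric] count_list_eq_length_filter length_filter_conv_card
    by (intro arg_cong [of _ _ card]) auto
  also have "{c. c < h \<and> ?g c = Suc i} = {?a (Suc i)..<?a i}"
    unfolding g using h by auto
  finally show ?thesis by simp
qed

text \<open>Each \<open>f l\<close> is counted once for every \<open>t < l\<close>.\<close>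

lemma sum_greaterThanAtMost_swap:
  fixes f :: "nat \<Rightarrow> nat"
  shows "(\<Sum>t<m. \<Sum>l\<in>{t<..m}. f l) = (\<Sum>l\<in>{1..m}. l * f l)"
proof (induction m)
  case (Suc m)
  have "(\<Sum>l\<in>{t<..Suc m}. f l) = (\<Sum>l\<in>{t<..m}. f l) + f (Suc m)" if "t \<le> m" for t
    using that by (simp add: atLeastSucAtMost_greaterThanAtMost [symmetric])
  then have "(\<Sum>t<Suc m. \<Sum>l\<in>{t<..Suc m}. f l) = (\<Sum>t<Suc m. (\<Sum>l\<in>{t<..m}. f l) + f (Suc m))"
    by (intro sum.cong) auto
  then show ?case by (simp add: sum.distrib Suc.IH)
qed simp

section \<open>The correspondence between \<open>Diff2_star\<close> and column
  multiplicities\<close>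

text \<open>The list inside \<open>col_star\<close> before zeros are dropped, so that its length is
  still the number of parts.\<close>

definition shifted :: "nat list \<Rightarrow> nat list" where
  "shifted xs = map (\<lambda>i. xs ! i - 2 * (length xs - i)) [0..<length xs]"

text \<open>The last part is at least 2, and each step towards the front adds at least 2. Hence
  subtracting the staircase never truncates.\<close>

lemma Diff2_star_ge: "xs \<in> Diff2_star \<Longrightarrow> t < length xs \<Longrightarrow> 2 * (length xs - t) \<le> xs ! t"
proof (induction "length xs - t" arbitrary: t)
  case (Suc d)
  have "2 \<le> xs ! t"
  proof -
    have "xs ! t \<in> set xs" using Suc.prems by simp
    moreover from this have "0 < xs ! t" using Suc.prems by (auto simp: Diff2_star_def Diff2_def is_partition_def)
    ultimately show ?thesis using Suc.prems(1)
      by (metis (mono_tags, lifting) Diff2_star_def One_nat_def Suc_1 Suc_leI le_neq_implies_less mem_Collect_eq)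
  qed
  show ?case
  proof (cases "Suc t < length xs")
    case True
    then have "2 * (length xs - Suc t) \<le> xs ! Suc t" using Suc by auto
    moreover have "xs ! t - xs ! Suc t \<ge> 2"
      using Suc.prems True by (auto simp: Diff2_star_def Diff2_def)
    ultimately show ?thesis by linarith
  next
    case False
    then show ?thesis using \<open>2 \<le> xs ! t\<close> Suc.prems by (simp add: Suc_leI le_antisym)
  qed
qed simp

lemma sorted_shifted:
  assumes "xs \<in> Diff2_star"
  shows "sorted_wrt (\<ge>) (shifted xs)"
proof -
  have "shifted xs ! Suc t \<le> shifted xs ! t" if "Suc t < length xs" for t
  proof -
    have "xs ! t - xs ! Suc t \<ge> 2" using assms that by (auto simp: Diff2_star_def Diff2_def)
    moreover have "2 * (length xs - t) = 2 * (length xs - Suc t) + 2" using that by linarith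
    ultimately show ?thesis using that Diff2_star_ge [OF assms that] by (simp add: shifted_def)
  qed
  then show ?thesis
    by (subst sorted_wrt_iff_nth_Suc_transp) (auto simp: shifted_def intro: transpI)
qed

lemma count_list_col_star:
  assumes "xs \<in> Diff2_star"
  shows "count_list (col_star xs) (Suc i)
    = (if i < length xs then shifted xs ! i else 0) - (if Suc i < length xs then shifted xs ! Suc i else 0)"
proof -
  have "col_star xs = conjugate (shifted xs)"
    unfolding col_star_def shifted_def [symmetric] by (rule conjugate_filter_nonzero [OF sorted_shifted [OF assms]])
  moreover have "length (shifted xs) = length xs" by (simp add: shifted_def)
  ultimately show ?thesis using count_list_conjugate [OF sorted_shifted [OF assms]] by simp
qed

text \<open>The inverse construction: row \<open>t\<close> consists of the staircase
  \<open>2 * (m - t)\<close> and one cell for each column longer than \<open>t\<close>, when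
  \<open>f l\<close> columns have length \<open>l\<close>.\<close>

definition unshift :: "nat \<Rightarrow> (nat \<Rightarrow> nat) \<Rightarrow> nat list" where
  "unshift m f = map (\<lambda>t. 2 * (m - t) + (\<Sum>l\<in>{t<..m}. f l)) [0..<m]"

lemma shifted_unshift: "shifted (unshift m f) = map (\<lambda>t. \<Sum>l\<in>{t<..m}. f l) [0..<m]"
proof -
  have "length (unshift m f) = m" by (simp add: unshift_def)
  moreover have "unshift m f ! t - 2 * (m - t) = (\<Sum>l\<in>{t<..m}. f l)" if "t \<in> set [0..<m]" for t
    using that by (simp add: unshift_def)
  ultimately show ?thesis unfolding shifted_def by (simp only: cong: map_cong)
qed

lemma unshift_Diff2_star: "unshift m f \<in> Diff2_star"
proof -
  have step: "(\<Sum>l\<in>{s<..m}. f l) \<le> (\<Sum>l\<in>{t<..m}. f l)" if "t \<le> s" for s t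
    using that by (intro sum_mono2) auto
  have le: "unshift m f ! s + 2 * (s - t) \<le> unshift m f ! t" if "t \<le> s" "s < m" for s t
    using step [OF that(1)] that by (simp add: unshift_def)
  have "sorted_wrt (\<ge>) (unshift m f)"
    unfolding sorted_wrt_iff_nth_less
  proof (intro allI impI)
    fix t s assume "t < s" "s < length (unshift m f)"
    then show "unshift m f ! t \<ge> unshift m f ! s" using le [of t s] by (simp add: unshift_def)
  qed
  moreover have "\<forall>t. Suc t < length (unshift m f) \<longrightarrow> unshift m f ! t - unshift m f ! Suc t \<ge> 2"
    using le [of "t" "Suc t" for t] by (force simp: unshift_def)
  moreover have "\<forall>x\<in>set (unshift m f). 0 < x \<and> x \<noteq> 1" by (auto simp: unshift_def)
  ultimately show ?thesis by (auto simp: Diff2_star_def Diff2_def is_partition_def)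
qed

text \<open>The staircase has size \<open>m * (m + 1)\<close>, the exponent of \<open>X\<close> in
  the sum side of the Rogers-Ramanujan identity.\<close>

lemma sum_list_unshift: "sum_list (unshift m f) = m * (m + 1) + (\<Sum>l\<in>{1..m}. l * f l)"
proof -
  have "sum_list (unshift m f) = (\<Sum>t<m. 2 * (m - t)) + (\<Sum>t<m. \<Sum>l\<in>{t<..m}. f l)"
    by (simp add: unshift_def interv_sum_list_conv_sum_set_nat atLeast0LessThan sum.distrib)
  also have "(\<Sum>t<m. 2 * (m - t)) = m * (m + 1)"
  proof (induction m)
    case (Suc m)
    have "(\<Sum>t<Suc m. 2 * (Suc m - t)) = (\<Sum>t<Suc m. 2 * (m - t) + 2)"
      by (intro sum.cong) auto
    also have "\<dots> = (\<Sum>t<Suc m. 2 * (m - t)) + 2 * Suc m"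
      by (simp only: sum.distrib) simp
    finally show ?case using Suc by simp
  qed simp
  finally show ?thesis by (simp only: sum_greaterThanAtMost_swap)
qed

lemma count_list_col_star_unshift:
  assumes "1 \<le> i" and "i \<le> m"
  shows "count_list (col_star (unshift m f)) i = f i"
proof -
  obtain t where i: "i = Suc t" using assms(1) by (cases i) auto
  have "{t<..m} = insert i {i<..m}" using assms i by auto
  then have "(\<Sum>l\<in>{t<..m}. f l) = f i + (\<Sum>l\<in>{i<..m}. f l)" by simp
  moreover have "length (unshift m f) = m" by (simp add: unshift_def)
  ultimately show ?thesis
    using assms(2) i count_list_col_star [OF unshift_Diff2_star, of m f t]
    by (auto simp: shifted_unshift)
qed

text \<open>Column multiplicities are differences of consecutive rows, so summing them from the last
  row upwards recovers the rows.\<close>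

lemma unshift_count_list_col_star:
  assumes xs: "xs \<in> Diff2_star" and f: "\<And>i. 1 \<le> i \<Longrightarrow> i \<le> length xs \<Longrightarrow> f i = count_list (col_star xs) i"
  shows "unshift (length xs) f = xs"
proof (rule nth_equalityI)
  let ?m = "length xs"
  let ?a = "\<lambda>i. if i < ?m then shifted xs ! i else 0"
  have "t \<le> ?m \<Longrightarrow> (\<Sum>l\<in>{t<..?m}. f l) = ?a t" for t
  proof (induction t rule: inc_induct)
    case (step t)
    have "{t<..?m} = insert (Suc t) {Suc t<..?m}" using step.hyps by auto
    then have "(\<Sum>l\<in>{t<..?m}. f l) = f (Suc t) + ?a (Suc t)" using step.IH by simp
    also have "f (Suc t) = ?a t - ?a (Suc t)"
      using f [of "Suc t"] step.hyps count_list_col_star [OF xs, of t] by simp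
    also have "\<dots> + ?a (Suc t) = ?a t"
    proof -
      \<comment> \<open>Monotonicity rules out truncation in the difference of the two rows.\<close>
      have "?a (Suc t) \<le> ?a t"
        using sorted_shifted [OF xs] by (auto simp: sorted_wrt_iff_nth_less shifted_def)
      then show ?thesis by simp
    qed
    finally show ?case .
  qed simp
  then show "unshift ?m f ! t = xs ! t" if "t < length (unshift ?m f)" for t
    using that Diff2_star_ge [OF xs, of t] by (simp add: unshift_def shifted_def)
qed (simp add: unshift_def)

text \<open>Column multiplicities identify these lists with \<open>mults {1..m} C\<close>, and the
  factor \<open>fps_X ^ (m * (m + 1))\<close> accounts for the staircase.\<close>

lemma card_Diff2_star:
  "of_nat (card {xs \<in> Diff2_star. length xs = m \<and> sum_list xs = n
        \<and> (\<forall>i\<in>{1..m}. count_list (col_star xs) i \<in> C i)})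
     = (fps_X ^ (m * (m + 1)) * (\<Prod>i\<in>{1..m}. part_gf i (C i))) $ n"
proof -
  let ?L = "{xs \<in> Diff2_star. length xs = m \<and> sum_list xs = n
        \<and> (\<forall>i\<in>{1..m}. count_list (col_star xs) i \<in> C i)}"
  \<comment> \<open>The cut-off outside \<open>{1..m}\<close> matches the normalisation in
    \<open>mults\<close>.\<close>
  define F where "F xs = (\<lambda>i. if i \<in> {1..m} then count_list (col_star xs) i else 0)" for xs
  have inv: "unshift m (F xs) = xs" if "xs \<in> Diff2_star" "length xs = m" for xs
    using unshift_count_list_col_star [OF that(1), of "F xs"] that(2) by (simp add: F_def)
  have sum: "sum_list xs = m * (m + 1) + (\<Sum>i\<in>{1..m}. i * F xs i)" if "xs \<in> Diff2_star" "length xs = m" for xs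
    using sum_list_unshift [of m "F xs"] inv [OF that] by simp
  show ?thesis
  proof (cases "m * (m + 1) \<le> n")
    case True
    have "bij_betw F ?L (mults {1..m} C (n - m * (m + 1)))"
    proof (rule bij_betw_byWitness [where f' = "unshift m"])
      show "\<forall>xs\<in>?L. unshift m (F xs) = xs" using inv by simp
      show "\<forall>f\<in>mults {1..m} C (n - m * (m + 1)). F (unshift m f) = f"
      proof
        fix f assume f: "f \<in> mults {1..m} C (n - m * (m + 1))"
        show "F (unshift m f) = f"
        proof
          fix i
          show "F (unshift m f) i = f i"
          proof (cases "i \<in> {1..m}")
            case True
            then show ?thesis by (simp add: F_def count_list_col_star_unshift)
          next
            case False
            then have "f i = 0" using f by (simp add: mults_def)
            then show ?thesis unfolding F_def if_not_P [OF False] by simp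
          qed
        qed
      qed
      show "F ` ?L \<subseteq> mults {1..m} C (n - m * (m + 1))"
      proof (rule image_subsetI)
        fix xs assume xs: "xs \<in> ?L"
        then have "(\<Sum>i\<in>{1..m}. i * F xs i) = n - m * (m + 1)"
          using sum [of xs] by simp
        moreover have "F xs i \<in> C i" if "i \<in> {1..m}" for i
          using xs that unfolding F_def by simp
        moreover have "F xs i = 0" if "i \<notin> {1..m}" for i
          unfolding F_def by (rule if_not_P [OF that])
        ultimately show "F xs \<in> mults {1..m} C (n - m * (m + 1))"
          unfolding mults_def by blast
      qed
      show "unshift m ` mults {1..m} C (n - m * (m + 1)) \<subseteq> ?L"
      proof (rule image_subsetI)
        fix f assume f: "f \<in> mults {1..m} C (n - m * (m + 1))"
        then have "(\<Sum>i\<in>{1..m}. i * f i) = n - m * (m + 1)" and C: "\<forall>i\<in>{1..m}. f i \<in> C i"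
          unfolding mults_def by blast+
        then have "sum_list (unshift m f) = n" using True sum_list_unshift [of m f] by simp
        moreover have "\<forall>i\<in>{1..m}. count_list (col_star (unshift m f)) i \<in> C i"
          using C by (simp add: count_list_col_star_unshift)
        ultimately show "unshift m f \<in> ?L"
          using unshift_Diff2_star [of m f] by (simp add: unshift_def)
      qed
    qed
    then have "card ?L = card (mults {1..m} C (n - m * (m + 1)))"
      by (rule bij_betw_same_card)
    then show ?thesis
      using card_mults [of "{1..m}" C "n - m * (m + 1)"] True by (simp add: fps_X_power_mult_nth)
  next
    case False
    \<comment> \<open>Every list with \<open>m\<close> parts already contains the staircase, so in
      this case both sides are 0.\<close>
    have "xs \<notin> ?L" for xs using sum [of xs] False by auto
    then have "?L = {}" by blast
    then have "card ?L = 0" by (simp only: card.empty)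
    then show ?thesis using False by (simp add: fps_X_power_mult_nth del: Collect_empty_eq)
  qed
qed

subsection \<open>Comparing the generating functions\<close>

text \<open>The simproc rewrites equations between polynomial power series into equations between
  polynomials, which gets in the way of the calculations below.\<close>

declare [[simproc del: poly_fps_eq]]

text \<open>The counting problems below restrict two multiplicities and leave the others free, which
  two function updates express.\<close>

lemma ball_fun_upd2:
  assumes "a \<in> I" and "b \<in> I" and "a \<noteq> b"
  shows "(\<forall>i\<in>I. f i \<in> ((\<lambda>_. UNIV)(a := A, b := B)) i) \<longleftrightarrow> f a \<in> A \<and> f b \<in> B"
  using assms by (simp add: fun_upd_def split: if_split) blast

text \<open>Free part sizes contribute geometric series. The factors \<open>1 - fps_X ^ a\<close>
  and \<open>1 - fps_X ^ b\<close> undo those of the two restricted sizes.\<close>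

lemma prod_part_gf:
  assumes "finite S" and "0 \<notin> S" and "a \<in> S" and "b \<in> S" and "a \<noteq> b"
  shows "(\<Prod>i\<in>S. part_gf i (((\<lambda>_. UNIV)(a := D, b := E)) i))
     = part_gf a D * (1 - fps_X ^ a) * (part_gf b E * (1 - fps_X ^ b)) * inverse (\<Prod>i\<in>S. 1 - fps_X ^ i)"
proof -
  have inv: "(1 - fps_X ^ i) * inverse (1 - fps_X ^ i) = (1 :: rat fps)" if "i > 0" for i
    using that by (intro inverse_mult_eq_1') (simp add: fps_power_zeroth zero_power)
  have ab: "a > 0" "b > 0" using assms by (auto intro: Nat.gr0I)
  have *: "(\<Prod>i\<in>S. f i) = f a * f b * (\<Prod>i\<in>S - {a, b}. f i)" for f :: "nat \<Rightarrow> rat fps"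
    using assms prod.subset_diff [of "{a, b}" S f] by (simp add: mult.commute)
  have "(\<Prod>i\<in>S - {a, b}. part_gf i (((\<lambda>_. UNIV)(a := D, b := E)) i))
      = (\<Prod>i\<in>S - {a, b}. inverse (1 - fps_X ^ i))"
  proof (intro prod.cong refl)
    fix i assume "i \<in> S - {a, b}"
    then show "part_gf i (((\<lambda>_. UNIV)(a := D, b := E)) i) = inverse (1 - fps_X ^ i)"
      using assms(2) part_gf_UNIV [of i] by (cases i) auto
  qed
  then have "(\<Prod>i\<in>S. part_gf i (((\<lambda>_. UNIV)(a := D, b := E)) i))
      = part_gf a D * part_gf b E * (\<Prod>i\<in>S - {a, b}. inverse (1 - fps_X ^ i))"
    using assms(5) unfolding * by simp
  also have "\<dots> = part_gf a D * part_gf b E * ((1 - fps_X ^ a) * inverse (1 - fps_X ^ a))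
      * ((1 - fps_X ^ b) * inverse (1 - fps_X ^ b)) * (\<Prod>i\<in>S - {a, b}. inverse (1 - fps_X ^ i))"
    by (simp only: inv ab mult_1_right)
  also have "\<dots> = part_gf a D * (1 - fps_X ^ a) * (part_gf b E * (1 - fps_X ^ b))
      * (\<Prod>i\<in>S. inverse (1 - fps_X ^ i))"
    unfolding * by (simp only: mult_ac)
  also have "(\<Prod>i\<in>S. inverse (1 - fps_X ^ i)) = inverse (\<Prod>i\<in>S. 1 - fps_X ^ i :: rat fps)"
    by (induction S rule: infinite_finite_induct) (simp_all add: fps_inverse_mult)
  finally show ?thesis .
qed

lemma qfac_fps_X: "qfac fps_X m = (\<Prod>i\<in>{1..m}. 1 - fps_X ^ i)"
proof (induction m)
  case (Suc m)
  have "{1..Suc m} = insert (Suc m) {1..m}" by auto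
  then show ?case by (simp only: qfac_Suc Suc.IH) (simp add: mult.commute del: power_Suc)
qed simp

text \<open>A finite geometric sum. For \<open>M > 0\<close> the right-hand side is also
  \<open>part_gf M {k} * (1 - fps_X ^ M)\<close>, so this block of multiplicities of 1 replaces
  having exactly \<open>k\<close> parts \<open>M\<close>.\<close>

lemma part_gf_interval:
  "part_gf 1 {M * k..<M * k + M} * (1 - fps_X ^ 1) = fps_X ^ (M * k) * (1 - fps_X ^ M)"
proof -
  have "part_gf 1 {M * k..<M * k + M} = (\<Sum>c\<in>{M * k..<M * k + M}. fps_X ^ c)"
    by (simp add: part_gf_finite)
  also have "\<dots> = (\<Sum>i<M. fps_X ^ (M * k + i))"
    by (rule sum.reindex_bij_witness [of _ "\<lambda>i. M * k + i" "\<lambda>c. c - M * k"]) auto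
  also have "\<dots> = fps_X ^ (M * k) * (\<Sum>i<M. fps_X ^ i)"
    by (simp add: power_add sum_distrib_left)
  finally show ?thesis
    by (simp only: power_one_right one_diff_power_eq mult_ac)
qed

text \<open>A finite supply \<open>S\<close> of part sizes suffices, since parts are at most
  \<open>N\<close>. The bound \<open>N + M \<le> n\<close> puts 2, \<open>M\<close> and all eligible
  parts into \<open>S\<close>.\<close>

lemma card_partitions_2_3_mod_5:
  assumes "M mod 5 = 2 \<or> M mod 5 = 3" and "M > 2" and "N + M \<le> n"
  shows "of_nat (card {xs. is_partition_of xs N \<and> (\<forall>x\<in>set xs. x mod 5 = 2 \<or> x mod 5 = 3)
              \<and> count_list xs M = k \<and> count_list xs 2 = j})
    = (fps_X ^ (2 * j + M * k) * (1 - fps_X ^ 2) * (1 - fps_X ^ M)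
        * inverse ((\<Prod>i\<le>n. 1 - fps_X ^ (5 * i + 2)) * (\<Prod>i\<le>n. 1 - fps_X ^ (5 * i + 3))) :: rat fps) $ N"
proof -
  define S where "S = (\<lambda>i. 5 * i + 2) ` {..n} \<union> (\<lambda>i. 5 * i + 3) ` {..n}"
  have memS: "x \<in> S \<longleftrightarrow> x mod 5 = 2 \<or> x mod 5 = 3" if "x \<le> n" for x
  proof
    assume "x mod 5 = 2 \<or> x mod 5 = 3"
    then have "x = 5 * (x div 5) + 2 \<or> x = 5 * (x div 5) + 3"
      using mult_div_mod_eq [of 5 x] by linarith
    moreover have "x div 5 \<in> {..n}" using that by simp
    ultimately show "x \<in> S"
      unfolding S_def Un_iff using rev_image_eqI [of "x div 5" "{..n}" x] by metis
  next
    assume "x \<in> S"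
    then obtain i where "x = 5 * i + 2 \<or> x = 5 * i + 3" unfolding S_def Un_iff image_iff by metis
    then show "x mod 5 = 2 \<or> x mod 5 = 3"
      by (elim disjE) (simp_all only: mod_mult_self4, simp_all)
  qed
  have S: "finite S" "0 \<notin> S" "2 \<in> S" "M \<in> S" "2 \<noteq> M"
    using assms memS [of M] memS [of 2] by (auto simp: S_def)
  have prodS: "(\<Prod>i\<in>S. 1 - fps_X ^ i) = ((\<Prod>i\<le>n. 1 - fps_X ^ (5 * i + 2)) * (\<Prod>i\<le>n. 1 - fps_X ^ (5 * i + 3)) :: rat fps)"
  proof -
    have "5 * a + 2 \<noteq> 5 * b + 3" for a b :: nat by presburger
    then have "(\<lambda>i. 5 * i + 2) ` {..n} \<inter> (\<lambda>i. 5 * i + 3) ` {..n} = {}" by blast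
    then show ?thesis unfolding S_def
      by (subst prod.union_disjoint) (auto simp: prod.reindex inj_on_def)
  qed
  let ?C = "(\<lambda>_. UNIV)(2 := {j}, M := {k})"
  have eq: "(\<forall>x\<in>set xs. x mod 5 = 2 \<or> x mod 5 = 3) \<and> count_list xs M = k \<and> count_list xs 2 = j
      \<longleftrightarrow> set xs \<subseteq> S \<and> (\<forall>i\<in>S. count_list xs i \<in> ?C i)" if "is_partition_of xs N" for xs
  proof -
    have "x \<le> n" if "x \<in> set xs" for x
      using member_le_sum_list [OF that] \<open>is_partition_of xs N\<close> assms(3) by (simp add: is_partition_of_def)
    then have "(\<forall>x\<in>set xs. x mod 5 = 2 \<or> x mod 5 = 3) \<longleftrightarrow> set xs \<subseteq> S"
      using memS by blast
    moreover have "(\<forall>i\<in>S. count_list xs i \<in> ?C i) \<longleftrightarrow> count_list xs M = k \<and> count_list xs 2 = j"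
      using ball_fun_upd2 [OF S(3-5), of "count_list xs" "{j}" "{k}"] by auto
    ultimately show ?thesis by (simp only: conj_assoc)
  qed
  have "{xs. is_partition_of xs N \<and> (\<forall>x\<in>set xs. x mod 5 = 2 \<or> x mod 5 = 3)
              \<and> count_list xs M = k \<and> count_list xs 2 = j}
      = {xs. is_partition_of xs N \<and> set xs \<subseteq> S \<and> (\<forall>i\<in>S. count_list xs i \<in> ?C i)}"
    using eq by blast
  then show ?thesis
    using card_partitions [OF S(1,2), of N ?C] assms(2)
    by (simp only: prod_part_gf [OF S] prodS) (simp add: part_gf_singleton power_add mult_ac)
qed

lemma length_le_sum_list:
  fixes xs :: "nat list"
  assumes "\<forall>x\<in>set xs. 0 < x"
  shows "length xs \<le> sum_list xs"
  using assms by (induction xs) auto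

lemma finite_partitions_of: "finite {xs. is_partition_of xs N}"
proof (rule finite_subset)
  show "{xs. is_partition_of xs N} \<subseteq> {xs. set xs \<subseteq> {..N} \<and> length xs \<le> N}"
    using member_le_sum_list length_le_sum_list by (auto simp: is_partition_of_def is_partition_def)
qed (rule finite_lists_length_le, simp)

section \<open>Partitions with one or two parts\<close>

text \<open>The two values excluded from the block of \<open>k\<close> reappear in the set for
  \<open>k + 1\<close>.\<close>

definition two_part_set :: "nat \<Rightarrow> nat \<Rightarrow> nat set" where
  "two_part_set M k = {c. (\<exists>i. i \<le> M - 1 \<and> i \<noteq> M - 3 \<and> i \<noteq> M - 6 \<and> c = M * k + i)
      \<or> (k \<ge> 1 \<and> (c = M * (k - 1) + (M - 3) \<or> c = M * (k - 1) + (M - 6)))}"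

text \<open>The factor \<open>fps_X ^ 6\<close> is the staircase for two parts. It moves
  \<open>M - 3\<close> and \<open>M - 6\<close> to \<open>M + 3\<close> and \<open>M\<close>, so
  both exceptional pairs become multiples of \<open>1 + fps_X ^ 3\<close>, and their difference has
  the factor \<open>1 - fps_X ^ M\<close>.\<close>

lemma part_gf_two_part_set:
  assumes "M \<ge> 7"
  shows "fps_X ^ 6 * part_gf 1 (two_part_set M k) * (1 - fps_X) + (if k = 0 then (1 + fps_X ^ 3) * (1 - fps_X) else 0)
     = fps_X ^ (M * k) * (1 - fps_X ^ M) * (1 - fps_X + fps_X ^ 3 * (1 - fps_X) + fps_X ^ 6)"
proof -
  let ?X = "fps_X :: rat fps"
  let ?I = "{M * k..<M * k + M}" and ?B = "{M * k + (M - 3), M * k + (M - 6)}"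
  let ?E = "if k = 0 then {} else {M * (k - 1) + (M - 3), M * (k - 1) + (M - 6)}"
  have set: "two_part_set M k = (?I - ?B) \<union> ?E"
  proof -
    have "(\<exists>i. i \<le> M - 1 \<and> i \<noteq> M - 3 \<and> i \<noteq> M - 6 \<and> c = M * k + i) \<longleftrightarrow> c \<in> ?I - ?B" for c
    proof
      assume "c \<in> ?I - ?B"
      then show "\<exists>i. i \<le> M - 1 \<and> i \<noteq> M - 3 \<and> i \<noteq> M - 6 \<and> c = M * k + i"
      proof (intro exI conjI)
        show "c = M * k + (c - M * k)" using \<open>c \<in> ?I - ?B\<close> by simp
        then show "c - M * k \<le> M - 1" "c - M * k \<noteq> M - 3" "c - M * k \<noteq> M - 6"
          using \<open>c \<in> ?I - ?B\<close> by (simp, linarith, (metis DiffD2 insertCI)+)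
      qed
    next
      assume "\<exists>i. i \<le> M - 1 \<and> i \<noteq> M - 3 \<and> i \<noteq> M - 6 \<and> c = M * k + i"
      then obtain i where "i \<le> M - 1" "i \<noteq> M - 3" "i \<noteq> M - 6" "c = M * k + i" by blast
      moreover from this(1) have "i < M" using assms by linarith
      ultimately show "c \<in> ?I - ?B" by simp
    qed
    moreover have "k \<ge> 1 \<and> (c = M * (k - 1) + (M - 3) \<or> c = M * (k - 1) + (M - 6)) \<longleftrightarrow> c \<in> ?E" for c
      by (cases k) simp_all
    ultimately show ?thesis unfolding two_part_set_def by blast
  qed
  \<comment> \<open>The adopted values lie below the block of \<open>k\<close>, which makes the
    union disjoint.\<close>
  have small: "c < M * k" if "c \<in> ?E" for c
    using that assms by (cases k) (auto split: if_splits)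
  have fin: "finite (two_part_set M k)" unfolding set by auto
  have "part_gf 1 (two_part_set M k) = (\<Sum>c\<in>two_part_set M k. ?X ^ c)"
    using fin by (simp add: part_gf_finite)
  also have "\<dots> = (\<Sum>c\<in>?I - ?B. ?X ^ c) + (\<Sum>c\<in>?E. ?X ^ c)"
    unfolding set by (rule sum.union_disjoint) (use small in fastforce)+
  also have "(\<Sum>c\<in>?I - ?B. ?X ^ c) = (\<Sum>c\<in>?I. ?X ^ c) - (\<Sum>c\<in>?B. ?X ^ c)"
    by (rule sum_diff) (use assms in auto)
  also have "(\<Sum>c\<in>?I. ?X ^ c) = part_gf 1 ?I" by (simp add: part_gf_finite)
  finally have 1: "part_gf 1 (two_part_set M k) = part_gf 1 ?I - (\<Sum>c\<in>?B. ?X ^ c) + (\<Sum>c\<in>?E. ?X ^ c)" .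
  have pair: "(\<Sum>c\<in>{d + (M - 3), d + (M - 6)}. ?X ^ c) = ?X ^ d * (?X ^ (M - 3) + ?X ^ (M - 6))" for d
  proof -
    have two: "a \<noteq> b \<Longrightarrow> (\<Sum>c\<in>{a, b}. ?X ^ c) = ?X ^ a + ?X ^ b" for a b
      by simp
    have "d + (M - 3) \<noteq> d + (M - 6)" using assms by simp
    from two [OF this] show ?thesis by (simp only: power_add distrib_left)
  qed
  have B: "?X ^ 6 * (\<Sum>c\<in>?B. ?X ^ c) = ?X ^ (M * k) * ?X ^ M * (1 + ?X ^ 3)"
  proof -
    have "(\<Sum>c\<in>?B. ?X ^ c) = ?X ^ (M * k) * (?X ^ (M - 3) + ?X ^ (M - 6))"
      by (rule pair)
    moreover have "?X ^ 6 * ?X ^ (M - 3) = ?X ^ M * ?X ^ 3" "?X ^ 6 * ?X ^ (M - 6) = ?X ^ M"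
      unfolding power_add [symmetric] using assms by simp_all
    ultimately show ?thesis by (simp add: algebra_simps)
  qed
  \<comment> \<open>For \<open>k = 0\<close> no values are adopted, and the contribution of the
    one-part partitions takes their place.\<close>
  have E: "?X ^ 6 * (\<Sum>c\<in>?E. ?X ^ c) + (if k = 0 then 1 + ?X ^ 3 else 0) = ?X ^ (M * k) * (1 + ?X ^ 3)"
  proof (cases k)
    case (Suc k')
    have "?X ^ 6 * (\<Sum>c\<in>?E. ?X ^ c) = ?X ^ (M * k') * (?X ^ 6 * ?X ^ (M - 3) + ?X ^ 6 * ?X ^ (M - 6))"
    proof -
      have "(\<Sum>c\<in>?E. ?X ^ c) = ?X ^ (M * k') * (?X ^ (M - 3) + ?X ^ (M - 6))"
        unfolding Suc if_not_P [OF nat.distinct(2)] diff_Suc_1 by (rule pair)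
      then show ?thesis by (simp only: distrib_left mult_ac)
    qed
    also have "?X ^ 6 * ?X ^ (M - 3) = ?X ^ M * ?X ^ 3"
      unfolding power_add [symmetric] using assms by simp
    also have "?X ^ 6 * ?X ^ (M - 6) = ?X ^ M"
      unfolding power_add [symmetric] using assms by simp
    finally show ?thesis using Suc by (simp add: power_add algebra_simps)
  qed simp
  have I: "part_gf 1 ?I * (1 - ?X) = ?X ^ (M * k) * (1 - ?X ^ M)"
    using part_gf_interval [of M k] by simp
  have "?X ^ 6 * part_gf 1 (two_part_set M k) * (1 - ?X) + (if k = 0 then (1 + ?X ^ 3) * (1 - ?X) else 0)
     = ?X ^ 6 * (part_gf 1 ?I * (1 - ?X)) - (?X ^ 6 * (\<Sum>c\<in>?B. ?X ^ c)) * (1 - ?X)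
        + (?X ^ 6 * (\<Sum>c\<in>?E. ?X ^ c) + (if k = 0 then 1 + ?X ^ 3 else 0)) * (1 - ?X)"
    unfolding 1 by (cases "k = 0") (simp_all add: algebra_simps)
  also have "\<dots> = ?X ^ (M * k) * (1 - ?X ^ M) * (1 - ?X + ?X ^ 3 * (1 - ?X) + ?X ^ 6)"
    unfolding I B E by (simp add: algebra_simps)
  finally show ?thesis .
qed

text \<open>Clearing denominators in the summands for 0, 1 and 2 produces the polynomial of
  \<open>part_gf_two_part_set\<close>.\<close>

lemma low_summands:
  fixes X :: "'a::field fps"
  defines "X \<equiv> fps_X"
  shows "(1 - X) * ((1 - X ^ 2) * (1 + X ^ 2 * inverse (qfac X 1) + X ^ 6 * inverse (qfac X 2)))
     = 1 - X + X ^ 3 * (1 - X) + X ^ 6"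
proof -
  have q1: "qfac X 1 = 1 - X"
    by (simp add: qfac_def)
  have q2: "qfac X 2 = (1 - X) * (1 - X ^ 2)"
    by (simp add: qfac_def numeral_2_eq_2)
  have u1: "(1 - X) * inverse (1 - X) = 1"
    by (rule inverse_mult_eq_1') (simp add: X_def)
  have u2: "(1 - X ^ 2) * inverse (1 - X ^ 2) = 1"
    by (rule inverse_mult_eq_1') (simp add: X_def fps_power_zeroth)
  have "(1 - X) * ((1 - X ^ 2) * (1 + X ^ 2 * inverse (qfac X 1) + X ^ 6 * inverse (qfac X 2)))
      = (1 - X ^ 2) * ((1 - X) + X ^ 2 * ((1 - X) * inverse (1 - X)))
        + X ^ 6 * ((1 - X) * inverse (1 - X) * ((1 - X ^ 2) * inverse (1 - X ^ 2)))"
    unfolding q1 q2 fps_inverse_mult by (simp only: distrib_left mult_1_right mult_1_left mult_ac)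
  also have "\<dots> = 1 - X + X ^ 3 * (1 - X) + X ^ 6"
    unfolding u1 u2 by (simp add: algebra_simps eval_nat_numeral)
  finally show ?thesis .
qed

text \<open>After multiplication by \<open>1 - fps_X\<close> both sides reduce to the same
  polynomial factor, and \<open>1 - fps_X\<close> may be cancelled in the domain of power
  series.\<close>

lemma low_terms:
  assumes "M \<ge> 7"
  shows "(if k = 0 then fps_X ^ (2 * j) + fps_X ^ (2 * j + 3) else 0)
       + fps_X ^ 6 * (\<Prod>i\<in>{1..2}. part_gf i (((\<lambda>_. UNIV)(2 := {j}, 1 := two_part_set M k)) i))
     = fps_X ^ (2 * j + M * k) * (1 - fps_X ^ 2) * (1 - fps_X ^ M)
        * (1 + fps_X ^ 2 * inverse (qfac fps_X 1) + fps_X ^ 6 * inverse (qfac fps_X 2))"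
    (is "?e + ?f = _ * ?g")
proof -
  let ?X = "fps_X :: rat fps"
  let ?P = "part_gf 1 (two_part_set M k)"
  have "{1..2} = {1, 2 :: nat}" by auto
  then have f: "?f = ?X ^ (2 * j) * (?X ^ 6 * ?P)"
    by (simp add: part_gf_singleton mult_ac)
  have e: "?e = ?X ^ (2 * j) * (if k = 0 then 1 + ?X ^ 3 else 0)"
    by (simp add: power_add algebra_simps)
  have "(1 - ?X) * (?e + ?f) = ?X ^ (2 * j) * (?X ^ 6 * ?P * (1 - ?X)
        + (if k = 0 then (1 + ?X ^ 3) * (1 - ?X) else 0))"
    unfolding e f by (simp add: algebra_simps)
  also have "\<dots> = ?X ^ (2 * j) * (?X ^ (M * k) * (1 - ?X ^ M) * ((1 - ?X) * ((1 - ?X ^ 2) * ?g)))"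
    unfolding part_gf_two_part_set [OF assms] low_summands ..
  also have "\<dots> = (1 - ?X) * (?X ^ (2 * j + M * k) * (1 - ?X ^ 2) * (1 - ?X ^ M) * ?g)"
    by (simp only: power_add mult_ac)
  finally have "(1 - ?X) * (?e + ?f) = (1 - ?X) * (?X ^ (2 * j + M * k) * (1 - ?X ^ 2) * (1 - ?X ^ M) * ?g)" .
  moreover have "1 - ?X \<noteq> 0"
  proof
    assume "1 - ?X = 0"
    then have "(1 - ?X) $ 0 = 0" by simp
    then show False by simp
  qed
  ultimately show ?thesis by (simp only: mult_cancel_left simp_thms)
qed

section \<open>Counting the admissible partitions by number of parts\<close>

definition admissible :: "nat \<Rightarrow> nat \<Rightarrow> nat \<Rightarrow> nat \<Rightarrow> nat list \<Rightarrow> bool" where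
  "admissible M N k j xs \<longleftrightarrow>
     (length xs = 1 \<and> (N = 2 * j \<or> N = 2 * j + 3) \<and> k = 0)
        \<or> (length xs = 2 \<and> count_list (col_star xs) 2 = j \<and>
            ((\<exists>i. i \<le> M - 1 \<and> i \<noteq> M - 3 \<and> i \<noteq> M - 6 \<and>
                 count_list (col_star xs) 1 = M * k + i)
             \<or> (k \<ge> 1 \<and> (count_list (col_star xs) 1 = M * (k - 1) + (M - 3) \<or>
                          count_list (col_star xs) 1 = M * (k - 1) + (M - 6)))))
        \<or> (3 \<le> length xs \<and> length xs \<le> M - 1 \<and> count_list (col_star xs) 2 = j \<and>
            M * k \<le> count_list (col_star xs) 1 \<and>
            count_list (col_star xs) 1 \<le> M * k + (M - 1))
        \<or> (M \<le> length xs \<and> count_list (col_star xs) 2 = j \<and>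
            count_list (col_star xs) M = k)"

text \<open>For \<open>m \<ge> 2\<close> the condition constrains multiplicities independently of
  each other. A single part is treated apart, since its condition concerns \<open>N\<close> and not
  the columns.\<close>

definition mult_sets :: "nat \<Rightarrow> nat \<Rightarrow> nat \<Rightarrow> nat \<Rightarrow> nat \<Rightarrow> nat set" where
  "mult_sets M k j m =
     (if m = 2 then (\<lambda>_. UNIV)(2 := {j}, 1 := two_part_set M k)
      else if m < M then (\<lambda>_. UNIV)(2 := {j}, 1 := {M * k..<M * k + M})
      else (\<lambda>_. UNIV)(2 := {j}, M := {k}))"

lemma admissible_iff:
  assumes "M \<ge> 7" and "length xs \<ge> 2"
  shows "admissible M N k j xs
    \<longleftrightarrow> (\<forall>i\<in>{1..length xs}. count_list (col_star xs) i \<in> mult_sets M k j (length xs) i)"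
proof -
  let ?c = "count_list (col_star xs)"
  consider "length xs = 2" | "3 \<le> length xs" "length xs < M" | "M \<le> length xs"
    using assms(2) by linarith
  then show ?thesis
  proof cases
    case 1
    then have "mult_sets M k j (length xs) = (\<lambda>_. UNIV)(2 := {j}, 1 := two_part_set M k)"
      by (simp add: mult_sets_def)
    then have "(\<forall>i\<in>{1..length xs}. ?c i \<in> mult_sets M k j (length xs) i) \<longleftrightarrow> ?c 2 \<in> {j} \<and> ?c 1 \<in> two_part_set M k"
      by (simp only:) (rule ball_fun_upd2, use 1 in auto)
    moreover have "\<not> 3 \<le> length xs" "\<not> M \<le> length xs" "length xs \<noteq> 1"
      using 1 assms(1) by simp_all
    ultimately show ?thesis
      using 1 unfolding admissible_def two_part_set_def mem_Collect_eq singleton_iff by blast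
  next
    case 2
    then have "mult_sets M k j (length xs) = (\<lambda>_. UNIV)(2 := {j}, 1 := {M * k..<M * k + M})"
      by (simp add: mult_sets_def)
    then have "(\<forall>i\<in>{1..length xs}. ?c i \<in> mult_sets M k j (length xs) i) \<longleftrightarrow> ?c 2 \<in> {j} \<and> ?c 1 \<in> {M * k..<M * k + M}"
      by (simp only:) (rule ball_fun_upd2, use 2 in auto)
    moreover have "?c 1 \<in> {M * k..<M * k + M} \<longleftrightarrow> M * k \<le> ?c 1 \<and> ?c 1 \<le> M * k + (M - 1)"
      using assms(1) by auto
    moreover have "\<not> M \<le> length xs" "length xs \<noteq> 1" "length xs \<noteq> 2" "length xs \<le> M - 1"
      using 2 by simp_all
    ultimately show ?thesis
      using 2(1) unfolding admissible_def singleton_iff by blast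
  next
    case 3
    with assms(1) have "mult_sets M k j (length xs) = (\<lambda>_. UNIV)(2 := {j}, M := {k})"
      by (simp add: mult_sets_def)
    then have "(\<forall>i\<in>{1..length xs}. ?c i \<in> mult_sets M k j (length xs) i) \<longleftrightarrow> ?c 2 \<in> {j} \<and> ?c M \<in> {k}"
      by (simp only:) (rule ball_fun_upd2, use 3 assms(1) in auto)
    moreover have "\<not> length xs \<le> M - 1" "length xs \<noteq> 1" "length xs \<noteq> 2"
      using 3 assms(1) by simp_all
    ultimately show ?thesis
      using 3 unfolding admissible_def singleton_iff by blast
  qed
qed

lemma card_admissible_ge_2:
  assumes "M \<ge> 7" and "m \<ge> 2"
  shows "of_nat (card {xs \<in> Diff2_star. length xs = m \<and> is_partition_of xs N \<and> admissible M N k j xs})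
     = (fps_X ^ (m * (m + 1)) * (\<Prod>i\<in>{1..m}. part_gf i (mult_sets M k j m i))) $ N"
proof -
  have "xs \<in> Diff2_star \<and> length xs = m \<and> is_partition_of xs N \<and> admissible M N k j xs
      \<longleftrightarrow> xs \<in> Diff2_star \<and> length xs = m \<and> sum_list xs = N
        \<and> (\<forall>i\<in>{1..m}. count_list (col_star xs) i \<in> mult_sets M k j m i)" for xs
    using admissible_iff [OF assms(1), of xs N k j] assms(2)
    unfolding is_partition_of_def Diff2_star_def Diff2_def by blast
  then show ?thesis using card_Diff2_star [of m N "mult_sets M k j m"] by (simp only:)
qed

text \<open>For \<open>m < M\<close> the block of ones supplies the factor
  \<open>fps_X ^ (M * k) * (1 - fps_X ^ M)\<close>; for \<open>m \<ge> M\<close> fixing the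
  multiplicity of \<open>M\<close> supplies the same factor.\<close>

lemma card_admissible_ge_3:
  assumes "M \<ge> 7" and "m \<ge> 3"
  shows "of_nat (card {xs \<in> Diff2_star. length xs = m \<and> is_partition_of xs N \<and> admissible M N k j xs})
     = (fps_X ^ (2 * j + M * k) * (1 - fps_X ^ 2) * (1 - fps_X ^ M)
          * (fps_X ^ (m * (m + 1)) * inverse (qfac fps_X m)) :: rat fps) $ N"
proof -
  let ?X = "fps_X :: rat fps"
  have S: "finite {1..m}" "0 \<notin> {1..m}" "2 \<in> {1..m}" using assms(2) by auto
  have "(\<Prod>i\<in>{1..m}. part_gf i (mult_sets M k j m i))
      = ?X ^ (2 * j + M * k) * (1 - ?X ^ 2) * (1 - ?X ^ M) * inverse (qfac ?X m)"
  proof (cases "m < M")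
    case True
    have "(\<Prod>i\<in>{1..m}. part_gf i (mult_sets M k j m i))
       = part_gf 2 {j} * (1 - ?X ^ 2) * (part_gf 1 {M * k..<M * k + M} * (1 - ?X ^ 1)) * inverse (qfac ?X m)"
      unfolding qfac_fps_X using S assms(2) True prod_part_gf [OF S, of 1] by (simp add: mult_sets_def)
    then show ?thesis
      unfolding part_gf_interval by (simp add: part_gf_singleton power_add mult_ac)
  next
    case False
    have "(\<Prod>i\<in>{1..m}. part_gf i (mult_sets M k j m i))
       = part_gf 2 {j} * (1 - ?X ^ 2) * (part_gf M {k} * (1 - ?X ^ M)) * inverse (qfac ?X m)"
      unfolding qfac_fps_X using S False assms prod_part_gf [OF S, of M] by (simp add: mult_sets_def)
    then show ?thesis
      using assms(1) by (simp add: part_gf_singleton power_add mult_ac)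
  qed
  moreover have "m \<ge> 2" using assms(2) by simp
  ultimately show ?thesis by (simp only: card_admissible_ge_2 [OF assms(1)] mult_ac)
qed

lemma card_admissible_1:
  assumes "M \<ge> 7" and "N \<ge> 1"
  shows "of_nat (card {xs \<in> Diff2_star. length xs = 1 \<and> is_partition_of xs N \<and> admissible M N k j xs})
     = (if k = 0 then fps_X ^ (2 * j) + fps_X ^ (2 * j + 3) else 0 :: rat fps) $ N"
    (is "of_nat (card ?A) = _")
proof -
  have adm: "admissible M N k j xs \<longleftrightarrow> (N = 2 * j \<or> N = 2 * j + 3) \<and> k = 0" if "length xs = 1" for xs
    using that assms(1) unfolding admissible_def by simp
  have "xs \<in> Diff2_star \<and> length xs = 1 \<and> is_partition_of xs N \<longleftrightarrow> xs = [N]" if "N \<ge> 2" for xs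
    using that by (cases xs)
      (auto simp: Diff2_star_def Diff2_def is_partition_def is_partition_of_def)
  \<comment> \<open>Here \<open>N \<ge> 1\<close> excludes \<open>j = 0\<close> in
    \<open>N = 2 * j\<close>, so \<open>[N]\<close> has no part 0 or 1.\<close>
  moreover have "N \<ge> 2" if "N = 2 * j \<or> N = 2 * j + 3"
    using that assms(2) by auto
  ultimately have "?A = (if k = 0 \<and> (N = 2 * j \<or> N = 2 * j + 3) then {[N]} else {})"
    using adm by (intro set_eqI) (simp, blast)
  then show ?thesis by simp
qed

text \<open>The lists are sorted by length: lengths 1 and 2 together match the first three summands,
  each longer length matches its own, and the Rogers-Ramanujan identity sums them.\<close>

lemma card_admissible:
  assumes "M \<ge> 7" and "N \<ge> 1" and "n \<ge> 2 * N + 2"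
  shows "of_nat (card {xs \<in> Diff2_star. is_partition_of xs N \<and> admissible M N k j xs})
     = (fps_X ^ (2 * j + M * k) * (1 - fps_X ^ 2) * (1 - fps_X ^ M)
        * inverse ((\<Prod>i\<le>n. 1 - fps_X ^ (5 * i + 2)) * (\<Prod>i\<le>n. 1 - fps_X ^ (5 * i + 3))) :: rat fps) $ N"
proof -
  let ?X = "fps_X :: rat fps"
  define K where "K = ?X ^ (2 * j + M * k) * (1 - ?X ^ 2) * (1 - ?X ^ M)"
  define summand where "summand m = ?X ^ (m * (m + 1)) * inverse (qfac ?X m)" for m
  define R where "R m = {xs \<in> Diff2_star. length xs = m \<and> is_partition_of xs N \<and> admissible M N k j xs}" for m
  \<comment> \<open>The empty list is absent because \<open>N \<ge> 1\<close>, yet the summand for 0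
    contributes; lengths 1 and 2 account for it.\<close>
  have low: "of_nat (card (R 1)) + of_nat (card (R 2)) = (K * (summand 0 + summand 1 + summand 2)) $ N"
  proof -
    have "summand 0 + summand 1 + summand 2 = 1 + ?X ^ 2 * inverse (qfac ?X 1) + ?X ^ 6 * inverse (qfac ?X 2)"
      by (simp add: summand_def power2_eq_square)
    moreover have "of_nat (card (R 2)) = (?X ^ 6 * (\<Prod>i\<in>{1..2}. part_gf i (((\<lambda>_. UNIV)(2 := {j}, 1 := two_part_set M k)) i))) $ N"
      using card_admissible_ge_2 [OF assms(1), of 2 N k j] by (simp only: R_def mult_sets_def) simp
    ultimately show ?thesis
      using low_terms [OF assms(1), of k j] card_admissible_1 [OF assms(1,2), of k j]
      by (simp only: K_def R_def fps_add_nth [symmetric])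
  qed
  have high: "of_nat (card (R m)) = (K * summand m) $ N" if "m \<ge> 3" for m
    unfolding R_def K_def summand_def by (rule card_admissible_ge_3 [OF assms(1) that])
  have fin: "finite (R m)" for m
    unfolding R_def by (rule finite_subset [OF _ finite_partitions_of [of N]]) blast
  have "length xs \<in> {1..n}" if "is_partition_of xs N" for xs
  proof -
    have "length xs \<le> N" "xs \<noteq> []"
      using that length_le_sum_list [of xs] assms(2) by (auto simp: is_partition_of_def is_partition_def)
    then show ?thesis using assms(3) by (simp add: Suc_le_eq)
  qed
  then have "{xs \<in> Diff2_star. is_partition_of xs N \<and> admissible M N k j xs} = (\<Union>m\<in>{1..n}. R m)"
    unfolding R_def by blast
  moreover have "card (\<Union>m\<in>{1..n}. R m) = (\<Sum>m\<in>{1..n}. card (R m))"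
    using fin by (intro card_UN_disjoint) (simp_all, unfold R_def, blast)
  ultimately have "of_nat (card {xs \<in> Diff2_star. is_partition_of xs N \<and> admissible M N k j xs})
      = (\<Sum>m\<in>{1..n}. of_nat (card (R m)) :: rat)"
    by (simp only: of_nat_sum)
  also have "{1..n} = {1, 2} \<union> {3..n}" using assms(3) by auto
  also have "(\<Sum>m\<in>{1, 2} \<union> {3..n}. of_nat (card (R m)))
      = (of_nat (card (R 1)) + of_nat (card (R 2)) :: rat) + (\<Sum>m\<in>{3..n}. of_nat (card (R m)))"
    by (subst sum.union_disjoint) auto
  also have "\<dots> = (K * (summand 0 + summand 1 + summand 2)) $ N + (\<Sum>m\<in>{3..n}. (K * summand m) $ N)"
    by (simp only: low) (simp add: high)
  also have "\<dots> = (K * (\<Sum>m\<le>n. summand m)) $ N"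
  proof -
    have "{..n} = {0, 1, 2} \<union> {3..n}" using assms(3) by auto
    then have "(\<Sum>m\<le>n. summand m) = summand 0 + summand 1 + summand 2 + (\<Sum>m\<in>{3..n}. summand m)"
      by (simp only:) (subst sum.union_disjoint, auto)
    then show ?thesis by (simp only: distrib_left [of K] sum_distrib_left fps_add_nth fps_sum_nth)
  qed
  also have "\<dots> = (K * inverse ((\<Prod>i\<le>n. 1 - ?X ^ (5 * i + 2)) * (\<Prod>i\<le>n. 1 - ?X ^ (5 * i + 3)))) $ N"
  proof -
    have "fps_eq_upto N (\<Sum>m\<le>n. summand m) (inverse ((\<Prod>i\<le>n. 1 - ?X ^ (5 * i + 2)) * (\<Prod>i\<le>n. 1 - ?X ^ (5 * i + 3))))"
      unfolding summand_def by (rule rogers_ramanujan_2_upto) (use assms(3) in simp)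
    then show ?thesis
      using fps_eq_upto_mult [OF fps_eq_upto_refl [of N K]] by (simp add: fps_eq_upto_def)
  qed
  finally show ?thesis unfolding K_def .
qed

theorem corollary1:
  fixes M N k j :: nat
  assumes "M \<ge> 7" and "M mod 5 = 2 \<or> M mod 5 = 3" and "N \<ge> 1"
  shows
    "card {xs. is_partition_of xs N \<and> (\<forall>x\<in>set xs. x mod 5 = 2 \<or> x mod 5 = 3) \<and>
               count_list xs M = k \<and> count_list xs 2 = j}
     = card {xs. xs \<in> Diff2_star \<and> is_partition_of xs N \<and>
         ((length xs = 1 \<and> (N = 2 * j \<or> N = 2 * j + 3) \<and> k = 0)
        \<or> (length xs = 2 \<and> count_list (col_star xs) 2 = j \<and>
            ((\<exists>i. i \<le> M - 1 \<and> i \<noteq> M - 3 \<and> i \<noteq> M - 6 \<and>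
                 count_list (col_star xs) 1 = M * k + i)
             \<or> (k \<ge> 1 \<and> (count_list (col_star xs) 1 = M * (k - 1) + (M - 3) \<or>
                          count_list (col_star xs) 1 = M * (k - 1) + (M - 6)))))
        \<or> (3 \<le> length xs \<and> length xs \<le> M - 1 \<and> count_list (col_star xs) 2 = j \<and>
            M * k \<le> count_list (col_star xs) 1 \<and>
            count_list (col_star xs) 1 \<le> M * k + (M - 1))
        \<or> (M \<le> length xs \<and> count_list (col_star xs) 2 = j \<and>
            count_list (col_star xs) M = k))}"
proof -
  \<comment> \<open>The value \<open>2 * N + M + 2\<close> for \<open>n\<close> meets both lower
    bounds, so the two counts are the same coefficient; \<open>of_nat\<close> into
    \<open>rat\<close> is injective.\<close>
  have "M > 2" and "N + M \<le> 2 * N + M + 2" and "2 * N + M + 2 \<ge> 2 * N + 2"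
    using assms(1) by simp_all
  then show ?thesis
    using card_partitions_2_3_mod_5 [OF assms(2), of N "2 * N + M + 2" k j]
      card_admissible [OF assms(1,3), of "2 * N + M + 2" k j, unfolded admissible_def]
    by (simp only: of_nat_eq_iff [where 'a = rat, symmetric])
qed

end
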